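(* For every $n \ge 1$, the map $\mathrm{R}$ is a bijection from $\mathcal{I}_n$ to $\mathcal{T}_n$, and its inverse is $T \mapsto [\mathrm{P}(T),\mathrm{Q}(T)]$.
   Context: A Dyck path of size $n$ is a word with $n$ letters $u=(1,1)$ and $n$ letters $d=(1,-1)$ whose walk from $(0,0)$ never goes below the $x$-axis. Tamari order: if $P=A\,d\,U\,C$ where $U=uBd$ is a Dyck path which returns to its starting height only at its end, then $P$ is covered by $A\,U\,d\,C$; the Tamari order $\le$ is the reflexive–transitive closure. For a Dyck path $P$ of size $n$ with up steps at positions $i_1<\dots<i_n$, $\mathrm{Type}(P)=w_1\cdots w_{n-1}$ where $w_k=E$ if the step at position $i_k+1$ is $u$ and $w_k=N$ otherwise. A synchronized interval of size $n$ is a pair $[P,Q]$ of Dyck paths of size $n$ with $P\le Q$ in Tamari order and $\mathrm{Type}(P)=\mathrm{Type}(Q)$; $\mathcal{I}_n$ is their set. Rooted plane trees: children of each vertex are linearly ordered; the root has depth $0$; a leaf is a non-root vertex without children, other vertices are internal; an internal edge is one whose lower endpoint is internal. The traversal is the depth-first traversal from the root visiting children in order; the traversal order of leaves is the order in which it meets them. The contour word of a plane tree writes $u$ when an edge is traversed away from the root and $d$ when traversed back; it is a bijection between plane trees with $n$ edges and Dyck paths of size $n$, the $i$-th up step corresponding to the $i$-th edge in traversal order, and leaves to up steps immediately followed by a down step. A decorated tree is a rooted plane tree with an integer label $\geq -1$ on each leaf such that: (1) if a leaf $\ell$ has parent of depth $p$, the label of $\ell$ is $<p$; (2) every internal vertex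 of depth $p>0$ has a descendant leaf with label $\le p-2$; (3) for any vertex $t$ of depth $p$ and any subtree $T'$ rooted at a child of $t$, if a leaf $\ell$ of $T'$ has label $p$ then every leaf of $T'$ preceding $\ell$ in traversal order has label $\ge p$. $\mathcal{T}_n$ is the set of decorated trees with $n$ edges. $\mathrm{Q}(T)$ is the contour word of $T$. $\mathrm{P}(T)$: give each leaf charge $0$; for each internal vertex of depth $p>0$, add $1$ to the charge of the first leaf (in traversal order) among its descendants with label $\le p-2$; then, during the traversal, append $u$ when an internal edge is first visited and $u d^{1+k}$ when a leaf of charge $k$ is first visited. The map $\mathrm{R}$: given $[P,Q]\in\mathcal{I}_n$, let $T$ be the plane tree whose contour word is $Q$. For each leaf $\ell$ corresponding to the $i$-th up step of $Q$, consider in $P$ the lowest point $x$ of the maximal run of consecutive down steps following the $i$-th up step of $P$; draw a horizontal ray from $x$ to the left until it first meets a point of $P$ which is the common point of two consecutive up steps. If this exists and the lower of these up steps is the $j$-th up step of $P$, let $e$ be the edge of $T$ corresponding to the $j$-th up step of $Q$ and label $\ell$ with the depth of the endpoint of $e$ closer to the root; otherwise label $\ell$ with $-1$. This gives $\mathrm{R}([P,Q])$. *)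

theory Defs
  imports Main "HOL-Library.Sublist"
begin

section \<open>Dyck paths and the Tamari order\<close>

datatype step = Up | Down

definition height :: "step list \<Rightarrow> nat \<Rightarrow> int" where
  "height w k = int (count_list (take k w) Up) - int (count_list (take k w) Down)"

definition dyck :: "nat \<Rightarrow> step list set" where
  "dyck n = {w. count_list w Up = n \<and> count_list w Down = n \<and>
                (\<forall>k\<le>length w. 0 \<le> height w k)}"

definition primitive_dyck :: "step list \<Rightarrow> bool" where
  "primitive_dyck w \<longleftrightarrow>
     (\<exists>m. w \<in> dyck m) \<and> (\<exists>B. w = Up # B @ [Down]) \<and>
     (\<forall>k. 0 < k \<and> k < length w \<longrightarrow> height w k \<noteq> 0)"

definition tamari_cover :: "nat \<Rightarrow> step list \<Rightarrow> step list \<Rightarrow> bool" where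
  "tamari_cover n P Q \<longleftrightarrow> P \<in> dyck n \<and>
     (\<exists>A V C. primitive_dyck V \<and> P = A @ [Down] @ V @ C \<and> Q = A @ V @ [Down] @ C)"

definition tamari_le :: "nat \<Rightarrow> step list \<Rightarrow> step list \<Rightarrow> bool" where
  "tamari_le n = (tamari_cover n)\<^sup>*\<^sup>*"

datatype letter = E | N

text \<open>Steps of a word are numbered from \<open>0\<close>, step \<open>i\<close> joining point \<open>i\<close> to point \<open>i + 1\<close>.\<close>

definition up_positions :: "step list \<Rightarrow> nat list" where
  "up_positions w = filter (\<lambda>i. w ! i = Up) [0..<length w]"

definition path_type :: "step list \<Rightarrow> letter list" where
  "path_type w = map (\<lambda>i. if w ! (i + 1) = Up then E else N) (butlast (up_positions w))"

definition sync_intervals :: "nat \<Rightarrow> (step list \<times> step list) set" where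
  "sync_intervals n =
     {(P, Q). P \<in> dyck n \<and> Q \<in> dyck n \<and> tamari_le n P Q \<and> path_type P = path_type Q}"

section \<open>Plane trees\<close>

datatype ptree = Node "ptree list"

fun num_edges :: "ptree \<Rightarrow> nat" where
  "num_edges (Node ts) = (\<Sum>t\<leftarrow>ts. 1 + num_edges t)"

fun contour :: "ptree \<Rightarrow> step list" where
  "contour (Node ts) = concat (map (\<lambda>t. Up # contour t @ [Down]) ts)"

text \<open>
  A vertex is represented by its address, the list of child indices (from \<open>0\<close>) on the
  path from the root to it. Thus \<open>[]\<close> is the root, the depth is the length, the parent of
  \<open>v \<noteq> []\<close> is \<open>butlast v\<close>, and descendants (in the reflexive sense) are
  extensions. \<open>traversal T\<close> lists the vertices in order of first visit; as the root is at
  index \<open>0\<close>, the \<open>i\<close>-th edge (\<open>i \<ge> 1\<close>) has lower endpoint \<open>traversal T ! i\<close>.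
\<close>

type_synonym vertex = "nat list"

fun traversal :: "ptree \<Rightarrow> vertex list" where
  "traversal (Node ts) =
     [] # concat (map (\<lambda>(i, vs). map ((#) i) vs) (enumerate 0 (map traversal ts)))"

definition vertices :: "ptree \<Rightarrow> vertex set" where
  "vertices T = set (traversal T)"

definition leaves :: "ptree \<Rightarrow> vertex set" where
  "leaves T = {v \<in> vertices T. v \<noteq> [] \<and> (\<forall>i. v @ [i] \<notin> vertices T)}"

definition internal_vertices :: "ptree \<Rightarrow> vertex set" where
  "internal_vertices T = vertices T - leaves T"

abbreviation depth :: "vertex \<Rightarrow> int" where
  "depth v \<equiv> int (length v)"

definition visit_index :: "ptree \<Rightarrow> vertex \<Rightarrow> nat" where
  "visit_index T v = length (takeWhile (\<lambda>x. x \<noteq> v) (traversal T))"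

definition precedes :: "ptree \<Rightarrow> vertex \<Rightarrow> vertex \<Rightarrow> bool" where
  "precedes T x y \<longleftrightarrow> visit_index T x < visit_index T y"

definition leaves_below :: "ptree \<Rightarrow> vertex \<Rightarrow> vertex set" where
  "leaves_below T v = {x \<in> leaves T. prefix v x}"

section \<open>Decorated trees\<close>

type_synonym labelled_tree = "ptree \<times> (vertex \<rightharpoonup> int)"

abbreviation label :: "(vertex \<rightharpoonup> int) \<Rightarrow> vertex \<Rightarrow> int" where
  "label L x \<equiv> the (L x)"

definition decorated_trees :: "nat \<Rightarrow> labelled_tree set" where
  "decorated_trees n =
     {(T, L). num_edges T = n \<and> dom L = leaves T \<and>
        (\<forall>x\<in>leaves T. label L x \<ge> -1) \<and>
        (\<forall>x\<in>leaves T. label L x < depth (butlast x)) \<and>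
        (\<forall>v\<in>internal_vertices T. depth v > 0 \<longrightarrow>
           (\<exists>x\<in>leaves_below T v. label L x \<le> depth v - 2)) \<and>
        (\<forall>t\<in>vertices T. \<forall>i. t @ [i] \<in> vertices T \<longrightarrow>
           (\<forall>x\<in>leaves_below T (t @ [i]). label L x = depth t \<longrightarrow>
              (\<forall>y\<in>leaves_below T (t @ [i]). precedes T y x \<longrightarrow> label L y \<ge> depth t)))}"

section \<open>From decorated trees to intervals\<close>

fun tree_Q :: "labelled_tree \<Rightarrow> step list" where
  "tree_Q (T, L) = contour T"

definition is_first_low_leaf :: "ptree \<Rightarrow> (vertex \<rightharpoonup> int) \<Rightarrow> vertex \<Rightarrow> vertex \<Rightarrow> bool" where
  "is_first_low_leaf T L v x \<longleftrightarrow>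
     x \<in> leaves_below T v \<and> label L x \<le> depth v - 2 \<and>
     (\<forall>y\<in>leaves_below T v. label L y \<le> depth v - 2 \<longrightarrow> \<not> precedes T y x)"

definition charge :: "ptree \<Rightarrow> (vertex \<rightharpoonup> int) \<Rightarrow> vertex \<Rightarrow> nat" where
  "charge T L x =
     card {v \<in> internal_vertices T. depth v > 0 \<and> is_first_low_leaf T L v x}"

fun tree_P :: "labelled_tree \<Rightarrow> step list" where
  "tree_P (T, L) =
     concat (map (\<lambda>v. if v \<in> leaves T then Up # replicate (1 + charge T L v) Down else [Up])
       (tl (traversal T)))"

section \<open>From intervals to decorated trees\<close>

text \<open>
  \<open>run_end P i\<close> is the index of the last point of the maximal run of down steps following
  the \<open>i\<close>-th up step of \<open>P\<close> (\<open>i \<ge> 1\<close>).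
\<close>

definition run_end :: "step list \<Rightarrow> nat \<Rightarrow> nat" where
  "run_end P i =
     (let a = up_positions P ! (i - 1) + 1
      in a + length (takeWhile (\<lambda>s. s = Down) (drop a P)))"

text \<open>The points on the horizontal ray from point \<open>x\<close> to the left that lie between two up steps.\<close>

definition ray_hits :: "step list \<Rightarrow> nat \<Rightarrow> nat set" where
  "ray_hits P x =
     {k. 0 < k \<and> k < x \<and> height P k = height P x \<and> P ! (k - 1) = Up \<and> P ! k = Up}"

text \<open>
  The first point met by the ray is the rightmost one. If it is point \<open>k\<close>, the lower of the two
  up steps is the last step of \<open>take k P\<close>, hence the \<open>j\<close>-th up step of \<open>P\<close>
  where \<open>j\<close> is the number of up steps in \<open>take k P\<close>.
\<close>

definition ray_label :: "step list \<Rightarrow> ptree \<Rightarrow> nat \<Rightarrow> int" where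
  "ray_label P T i =
     (let H = ray_hits P (run_end P i)
      in if H = {} then -1
         else let j = count_list (take (Max H) P) Up in depth (butlast (traversal T ! j)))"

fun interval_R :: "step list \<times> step list \<Rightarrow> labelled_tree" where
  "interval_R (P, Q) =
     (let T = (THE T. contour T = Q)
      in (T, \<lambda>v. if v \<in> leaves T then Some (ray_label P T (visit_index T v)) else None))"

end

theory Submission
  imports Defs
begin

text \<open>
  Encode a Dyck path by its depth sequence, the heights reached by its up steps. In the plane tree
  with contour \<open>P\<close>, vertex \<open>x\<close> is a descendant of \<open>v\<close> iff all depths in positions
  \<open>v < k \<le> x\<close> exceed the depth of \<open>v\<close>. Then \<open>P \<le> Q\<close> in the Tamari order iff
  every descendant pair of \<open>P\<close> is one of \<open>Q\<close>, and equality of types says that the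
  leaves are the same. The ray drawn from the run after a leaf \<open>x\<close> ends at the parent of
  \<open>x + 1\<close> in the tree of \<open>P\<close>. So a leaf \<open>x\<close> below \<open>v\<close> in the tree of
  \<open>Q\<close> has label at least \<open>depth v - 1\<close> as long as \<open>x + 1\<close> is still a
  descendant of \<open>v\<close> in the tree of \<open>P\<close>, and the last descendant of \<open>v\<close> there
  is the first leaf with label at most \<open>depth v - 2\<close>. This is how the charges recover the down
  steps of \<open>P\<close>; conversely condition (3) makes the ray return the given label.
\<close>

section \<open>Depth sequences\<close>

text \<open>Preorder positions name the vertices of the tree of \<open>P\<close> and of the tree of
  \<open>Q\<close> at once, so the two descendant relations live on the same set and can be compared
  directly. A Tamari cover raises one whole subtree by one level, which only adds descendant pairs.
  Conversely, if every pair of \<open>P\<close> is a pair of \<open>Q\<close> and the paths differ,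
  then \<open>P\<close> is the lower one at the first difference, and raising the subtree that
  starts there creates no pair foreign to \<open>Q\<close>. Starting from a decoration, the lower
  path has to be constructed, and only the intended last descendant of each vertex is known. The
  resulting intervals of positions are nested or disjoint, and counting the intervals around a
  position gives its depth. It then remains to see that the ray returns the prescribed label. That
  the label is not too small follows from choosing the first low leaf; equality needs condition (3),
  which keeps the interval of the ancestor that the label points to open beyond the leaf. A ray that
  hits nothing means that the parent is the root, and \<open>q 0 - 1 = -1\<close> makes
  \<open>-1\<close> an ordinary label.\<close>

text \<open>
  Sequences are continued by \<open>1\<close> beyond \<open>n\<close>, as if infinitely many leaves were attached to
  the root; this makes the last run of down steps an ordinary one.
\<close>

definition depth_seq :: "nat \<Rightarrow> (nat \<Rightarrow> int) \<Rightarrow> bool" where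
  "depth_seq n p \<longleftrightarrow>
     p 0 = 0 \<and> (\<forall>i. 1 \<le> p (Suc i) \<and> p (Suc i) \<le> p i + 1) \<and> (\<forall>i>n. p i = 1)"

definition desc :: "(nat \<Rightarrow> int) \<Rightarrow> nat \<Rightarrow> nat \<Rightarrow> bool" where
  "desc p v x \<longleftrightarrow> v \<le> x \<and> (\<forall>k. v < k \<and> k \<le> x \<longrightarrow> p v < p k)"

lemma depth_seqD:
  assumes "depth_seq n p"
  shows "p 0 = 0" "1 \<le> p (Suc i)" "p (Suc i) \<le> p i + 1" "n < i \<Longrightarrow> p i = 1"
  using assms by (auto simp: depth_seq_def)

lemma depth_seq_pos: "depth_seq n p \<Longrightarrow> 1 \<le> i \<Longrightarrow> 1 \<le> p i"
  by (cases i) (auto simp: depth_seq_def)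

lemma depth_seq_nonneg: "depth_seq n p \<Longrightarrow> 0 \<le> p i"
  using depth_seq_pos[of n p i] depth_seqD(1)[of n p] by (cases i) auto

lemma desc_refl [simp]: "desc p v v"
  by (simp add: desc_def)

lemma desc_le: "desc p v x \<Longrightarrow> v \<le> x"
  by (simp add: desc_def)

lemma desc_less: "desc p v x \<Longrightarrow> v \<noteq> x \<Longrightarrow> p v < p x"
  by (auto simp: desc_def)

lemma desc_depth_le: "desc p v x \<Longrightarrow> p v \<le> p x"
  using desc_less[of p v x] by (cases "v = x") auto

lemma desc_between: "desc p v x \<Longrightarrow> v \<le> w \<Longrightarrow> w \<le> x \<Longrightarrow> desc p v w"
  by (auto simp: desc_def)

lemma desc_trans:
  assumes "desc p u v" "desc p v w" shows "desc p u w"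
  unfolding desc_def
proof (intro conjI allI impI)
  show "u \<le> w" using assms by (auto simp: desc_def)
  fix k assume k: "u < k \<and> k \<le> w"
  show "p u < p k"
  proof (cases "k \<le> v")
    case True then show ?thesis using assms(1) k by (auto simp: desc_def)
  next
    case False
    then have "p v < p k" using assms(2) k by (auto simp: desc_def)
    with desc_depth_le[OF assms(1)] show ?thesis by simp
  qed
qed

lemma desc_root: "depth_seq n p \<Longrightarrow> desc p 0 x"
  unfolding desc_def by (auto simp: depth_seqD(1) intro: less_le_trans[OF _ depth_seq_pos])

lemma desc_Suc: "desc p v (Suc x) \<longleftrightarrow> v = Suc x \<or> desc p v x \<and> p v < p (Suc x)"
  by (auto simp: desc_def le_Suc_eq)

lemma desc_bounded:
  assumes "depth_seq n p" "1 \<le> v" "desc p v x" "v < x"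
  shows "x \<le> n"
proof (rule ccontr)
  assume "\<not> x \<le> n"
  then have "p x = 1" using depth_seqD(4)[OF assms(1)] by simp
  moreover have "p v < p x" using assms by (auto simp: desc_def)
  ultimately show False using depth_seq_pos[OF assms(1,2)] by simp
qed

lemma desc_eq_depth:
  assumes "desc p v x" "desc p w x" "p v = p w" shows "v = w"
  using assms by (metis desc_def less_irrefl linorder_neqE_nat)

text \<open>Depths rise by at most one per step, so no level is skipped: if \<open>a\<close> lies
  below the depth of \<open>Suc x\<close>, it is at most the depth of \<open>x\<close>, and the
  ancestor found for \<open>x\<close> also serves \<open>Suc x\<close>.\<close>

lemma ancestor_of_depth:
  assumes "depth_seq n p"
  shows "0 \<le> a \<Longrightarrow> a \<le> p x \<Longrightarrow> \<exists>v. desc p v x \<and> p v = a"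
proof (induction x)
  case 0
  then show ?case using depth_seqD(1)[OF assms] by (intro exI[of _ 0]) auto
next
  case (Suc x)
  show ?case
  proof (cases "a = p (Suc x)")
    case True then show ?thesis by (intro exI[of _ "Suc x"]) auto
  next
    case False
    then have "a < p (Suc x)" using Suc by simp
    moreover from this have "a \<le> p x" using depth_seqD(3)[OF assms, of x] by simp
    ultimately show ?thesis using Suc by (auto simp: desc_Suc)
  qed
qed

lemma parent_exists:
  assumes "depth_seq n p"
  obtains w where "w \<le> x" "desc p w (Suc x)" "p w = p (Suc x) - 1"
proof -
  have "0 \<le> p (Suc x) - 1" using depth_seqD(2)[OF assms, of x] by simp
  then obtain w where w: "desc p w (Suc x)" "p w = p (Suc x) - 1"
    using ancestor_of_depth[OF assms, of "p (Suc x) - 1" "Suc x"] by auto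
  moreover have "w \<noteq> Suc x" using w by auto
  ultimately show ?thesis using that[of w] desc_le[OF w(1)] by simp
qed

text \<open>An ancestor strictly between the parent and \<open>Suc x\<close> would have a depth
  strictly between two consecutive integers.\<close>

lemma desc_via_parent:
  assumes "desc p w (Suc x)" "p w = p (Suc x) - 1" "desc p v (Suc x)" "v \<le> x"
  shows "desc p v w"
proof -
  have "v \<le> w"
  proof (rule ccontr)
    assume "\<not> v \<le> w"
    then have "p w < p v" using assms by (auto simp: desc_def)
    moreover have "p v < p (Suc x)" using assms by (auto simp: desc_def)
    ultimately show False using assms(2) by simp
  qed
  then show ?thesis using desc_between[OF assms(3)] desc_le[OF assms(1)] by simp
qed

definition proper_ancestors :: "(nat \<Rightarrow> int) \<Rightarrow> nat \<Rightarrow> nat set" where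
  "proper_ancestors p x = {v. v < x \<and> desc p v x}"

lemma finite_proper_ancestors: "finite (proper_ancestors p x)"
  by (rule finite_subset[of _ "{..<x}"]) (auto simp: proper_ancestors_def)

text \<open>Turns a depth into a cardinality, so that the length of a run of down steps, a
  difference of depths, can be compared with a charge, which counts vertices.\<close>

lemma card_proper_ancestors:
  assumes "depth_seq n p"
  shows "int (card (proper_ancestors p x)) = p x"
proof (induction x rule: less_induct)
  case (less x)
  show ?case
  proof (cases x)
    case 0
    then show ?thesis using depth_seqD(1)[OF assms] by (simp add: proper_ancestors_def)
  next
    case (Suc y)
    obtain w where w: "w \<le> y" "desc p w (Suc y)" "p w = p (Suc y) - 1"
      using parent_exists[OF assms] by blast
    have "proper_ancestors p x = insert w (proper_ancestors p w)"
    proof (intro set_eqI iffI)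
      fix v assume "v \<in> proper_ancestors p x"
      then have "desc p v w" "v < Suc y"
        using desc_via_parent[OF w(2,3)] Suc by (auto simp: proper_ancestors_def)
      then show "v \<in> insert w (proper_ancestors p w)"
        using desc_le by (force simp: proper_ancestors_def)
    next
      fix v assume "v \<in> insert w (proper_ancestors p w)"
      then show "v \<in> proper_ancestors p x"
        using w desc_trans[OF _ w(2)] Suc by (auto simp: proper_ancestors_def)
    qed
    moreover have "w \<notin> proper_ancestors p w" by (simp add: proper_ancestors_def)
    moreover have "int (card (proper_ancestors p w)) = p w" using less[of w] w Suc by simp
    ultimately show ?thesis using w Suc finite_proper_ancestors[of p w] by simp
  qed
qed

text \<open>These \<open>v\<close> are the internal vertices whose down step lies in the run after a leaf \<open>x\<close>.\<close>

lemma card_last_descendant: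
  assumes p: "depth_seq n p" and x: "1 \<le> x" "p (Suc x) \<le> p x"
  shows "int (card {v. 1 \<le> v \<and> v < x \<and> desc p v x \<and> \<not> desc p v (Suc x)}) = p x - p (Suc x)"
proof -
  have "{v. 1 \<le> v \<and> v < x \<and> desc p v x \<and> \<not> desc p v (Suc x)}
      = proper_ancestors p x - proper_ancestors p (Suc x)"
    using desc_root[OF p] x by (auto simp: proper_ancestors_def Suc_le_eq intro: gr0I)
  moreover have "proper_ancestors p (Suc x) \<subseteq> proper_ancestors p x"
    using x by (auto simp: proper_ancestors_def desc_Suc less_Suc_eq)
  ultimately show ?thesis
    using card_Diff_subset[of "proper_ancestors p (Suc x)" "proper_ancestors p x"]
      card_mono[of "proper_ancestors p x" "proper_ancestors p (Suc x)"]
      card_proper_ancestors[OF p, of x] card_proper_ancestors[OF p, of "Suc x"]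
      finite_proper_ancestors[of p]
    by simp
qed

text \<open>The tail of ones ends the subtree of every vertex except the root, so the descent from
  \<open>v\<close> must break at some step.\<close>

lemma last_descendant_exists:
  assumes p: "depth_seq n p" and v: "1 \<le> v"
  obtains x where "desc p v x" "\<not> desc p v (Suc x)"
proof -
  have "\<not> desc p v (v + Suc n)"
    using desc_bounded[OF p v, of "v + Suc n"] by auto
  then have "\<exists>k. desc p v (v + k) \<and> \<not> desc p v (v + Suc k)"
    using nat_induct[of "\<lambda>k. desc p v (v + k)" "Suc n"] by auto
  then show ?thesis using that by auto
qed

section \<open>The Tamari order on depth sequences\<close>

text \<open>Effect of a Tamari cover on depths: a down step moves from before a primitive block to
  behind it, and the up steps of that block, numbered \<open>Suc m\<close> to \<open>m'\<close>, end
  one level higher.\<close>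

definition lift_step :: "nat \<Rightarrow> nat \<Rightarrow> (nat \<Rightarrow> int) \<Rightarrow> nat \<Rightarrow> int" where
  "lift_step m m' p k = (if m < k \<and> k \<le> m' then p k + 1 else p k)"

text \<open>For \<open>i\<close> outside the block, other depths can only grow. For \<open>i\<close>
  inside, the block is the whole subtree of \<open>Suc m\<close>, so the descendants of
  \<open>i\<close> stay inside and are raised together with \<open>i\<close>.\<close>

lemma lift_step_desc:
  assumes m: "p (Suc m') \<le> p (Suc m)" "desc p (Suc m) m'"
    and d: "desc p i j"
  shows "desc (lift_step m m' p) i j"
proof (cases "m < i \<and> i \<le> m'")
  case False
  then show ?thesis using d by (auto simp: desc_def lift_step_def intro: less_trans[OF _ less_add_one])
next
  case True
  have "p (Suc m) \<le> p i" using desc_depth_le[OF desc_between[OF m(2)], of i] True by simp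
  then have "\<not> p i < p (Suc m')" using m(1) by simp
  then have "j \<le> m'" using d True unfolding desc_def by (meson le_imp_less_Suc not_less_eq_eq)
  then show ?thesis using d True by (auto simp: desc_def lift_step_def)
qed

text \<open>A pair created by the lift joins an \<open>i\<close> before the block, of the same depth
  as its root \<open>Suc m\<close>, to a \<open>j\<close> in the block. Since \<open>q\<close>
  equals \<open>p\<close> up to \<open>m\<close>, exceeds it at \<open>Suc m\<close> and keeps all
  descendants of \<open>Suc m\<close>, the pair already belongs to \<open>q\<close>.\<close>

lemma lift_step_below:
  assumes sub: "\<And>i j. desc p i j \<Longrightarrow> desc q i j"
    and eq: "\<And>k. k \<le> m \<Longrightarrow> p k = q k" and lt: "p (Suc m) < q (Suc m)"
    and m: "p (Suc m') \<le> p (Suc m)" "desc p (Suc m) m'"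
    and d: "desc (lift_step m m' p) i j"
  shows "desc q i j"
proof (cases "desc p i j")
  case True then show ?thesis by (rule sub)
next
  case False
  let ?p = "lift_step m m' p"
  have ij: "i \<le> j" using d by (simp add: desc_def)
  \<comment> \<open>The position \<open>k\<close> blocks the pair in \<open>p\<close> but no longer
    after the lift. As a lift adds only one, \<open>k\<close> was level with \<open>i\<close>, and
    \<open>k\<close> is raised while \<open>i\<close> is not.\<close>
  with False obtain k where k: "i < k" "k \<le> j" "p k \<le> p i" by (auto simp: desc_def)
  have k': "?p i < ?p k" using d k by (simp add: desc_def)
  have km: "m < k" "k \<le> m'" and pk: "p k = p i" and pi: "?p i = p i"
    using k k' by (auto simp: lift_step_def split: if_splits)
  have im: "i \<le> m" using pi km k(1) by (auto simp: lift_step_def split: if_splits)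
  have "p (Suc m) \<le> p k" using desc_depth_le[OF desc_between[OF m(2)], of k] km by simp
  moreover have "?p i < ?p (Suc m)" using d im k km by (auto simp: desc_def)
  then have "p i \<le> p (Suc m)" using pi by (auto simp: lift_step_def split: if_splits)
  ultimately have pm: "p (Suc m) = p i" using pk by simp
  have jm: "j \<le> m'"
  proof (rule ccontr)
    assume "\<not> j \<le> m'"
    then have "?p i < ?p (Suc m')" using d im km by (simp add: desc_def)
    then show False using pi pm m by (simp add: lift_step_def)
  qed
  show ?thesis unfolding desc_def
  proof (intro conjI allI impI)
    fix l assume l: "i < l \<and> l \<le> j"
    show "q i < q l"
    proof (cases "l \<le> m")
      case True
      have "?p i < ?p l" using d l by (simp add: desc_def)
      then show ?thesis using True eq[OF True] eq[OF im] pi by (simp add: lift_step_def)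
    next
      case False
      have "desc q (Suc m) l" using sub desc_between[OF m(2), of l] False l jm by simp
      then show ?thesis using desc_depth_le[of q "Suc m" l] lt pm eq[OF im] by simp
    qed
  qed (rule ij)
qed

text \<open>The parent of \<open>Suc m\<close> in \<open>p\<close> lies where both sequences agree
  and is still an ancestor in \<open>q\<close>, hence \<open>p\<close> is the smaller one at
  \<open>Suc m\<close>. Since \<open>q\<close> climbs by at most one there, \<open>p\<close> does
  not climb at all, so a down step precedes up step \<open>Suc m\<close> and a cover is
  possible.\<close>

lemma first_difference:
  assumes p: "depth_seq n p" and q: "depth_seq n q"
    and sub: "\<And>i j. desc p i j \<Longrightarrow> desc q i j" and ne: "p \<noteq> q"
  obtains m where "1 \<le> m" "m < n" "\<And>k. k \<le> m \<Longrightarrow> p k = q k" "p (Suc m) < q (Suc m)"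
    "p (Suc m) \<le> p m"
proof -
  define l where "l = (LEAST k. p k \<noteq> q k)"
  have l: "p l \<noteq> q l" unfolding l_def using LeastI_ex[of "\<lambda>k. p k \<noteq> q k"] ne by (simp add: fun_eq_iff)
  have eq: "p k = q k" if "k < l" for k using that not_less_Least[of k "\<lambda>k. p k \<noteq> q k"] by (simp add: l_def)
  have "l \<noteq> 0" using l depth_seqD(1)[OF p] depth_seqD(1)[OF q] by (cases l) simp_all
  then obtain m where m: "l = Suc m" by (cases l) auto
  have "m \<noteq> 0" using l m depth_seqD(1)[OF p] depth_seqD(2,3)[OF p, of 0]
      depth_seqD(1)[OF q] depth_seqD(2,3)[OF q, of 0] by (intro notI) simp
  moreover have "m < n" using l m depth_seqD(4)[OF p, of l] depth_seqD(4)[OF q, of l] by force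
  moreover have eq': "p k = q k" if "k \<le> m" for k using that eq m by simp
  moreover have lt: "p (Suc m) < q (Suc m)"
  proof -
    obtain w where w: "w \<le> m" "desc p w (Suc m)" "p w = p (Suc m) - 1"
      using parent_exists[OF p] by blast
    have "q w < q (Suc m)" using sub[OF w(2)] w(1) by (simp add: desc_def)
    then show ?thesis using eq'[OF w(1)] w(3) l m by simp
  qed
  moreover have "p (Suc m) \<le> p m" using lt depth_seqD(3)[OF q, of m] eq'[of m] by simp
  ultimately show ?thesis using that[of m] by simp
qed

section \<open>Decorations of depth sequences\<close>

abbreviation leaf_at :: "(nat \<Rightarrow> int) \<Rightarrow> nat \<Rightarrow> bool" where
  "leaf_at p x \<equiv> p (Suc x) \<le> p x"

text \<open>The three conditions on decorated trees, with \<open>q x - 1\<close> for the depth of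
  the parent of \<open>x\<close>. The second is also asked of leaves, where the first implies it;
  the third is indexed by the root \<open>v\<close> of the subtree instead of its parent
  \<open>t\<close>.\<close>

definition decoration :: "(nat \<Rightarrow> int) \<Rightarrow> (nat \<Rightarrow> int) \<Rightarrow> bool" where
  "decoration q l \<longleftrightarrow>
     (\<forall>x\<ge>1. leaf_at q x \<longrightarrow> -1 \<le> l x \<and> l x \<le> q x - 2) \<and>
     (\<forall>v\<ge>1. \<exists>x. leaf_at q x \<and> desc q v x \<and> l x \<le> q v - 2) \<and>
     (\<forall>v\<ge>1. \<forall>x y. leaf_at q x \<longrightarrow> leaf_at q y \<longrightarrow> desc q v x \<longrightarrow> desc q v y \<longrightarrow>
        l x = q v - 1 \<longrightarrow> y < x \<longrightarrow> q v - 1 \<le> l y)"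

lemma decoration_before:
  assumes "decoration q l" "1 \<le> v" "leaf_at q x" "leaf_at q y" "desc q v x" "desc q v y"
    "l x = q v - 1" "y < x"
  shows "q v - 1 \<le> l y"
  using assms unfolding decoration_def by blast

definition first_low :: "(nat \<Rightarrow> int) \<Rightarrow> (nat \<Rightarrow> int) \<Rightarrow> nat \<Rightarrow> nat \<Rightarrow> bool" where
  "first_low q l v x \<longleftrightarrow> leaf_at q x \<and> desc q v x \<and> l x \<le> q v - 2 \<and>
     (\<forall>y<x. leaf_at q y \<longrightarrow> desc q v y \<longrightarrow> q v - 2 < l y)"

definition sync_seqs :: "nat \<Rightarrow> (nat \<Rightarrow> int) \<Rightarrow> (nat \<Rightarrow> int) \<Rightarrow> bool" where
  "sync_seqs n p q \<longleftrightarrow> depth_seq n p \<and> depth_seq n q \<and>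
     (\<forall>i j. desc p i j \<longrightarrow> desc q i j) \<and> (\<forall>i\<ge>1. leaf_at p i \<longleftrightarrow> leaf_at q i)"

text \<open>Here \<open>w\<close> is the parent of \<open>Suc x\<close> in the tree of
  \<open>p\<close>, and \<open>q w - 1\<close> is the depth in the tree of \<open>q\<close> of the
  upper end of the edge above \<open>w\<close>. For \<open>w = 0\<close> this is \<open>-1\<close>,
  which covers the ray without a hit.\<close>

definition ray_labelling :: "(nat \<Rightarrow> int) \<Rightarrow> (nat \<Rightarrow> int) \<Rightarrow> (nat \<Rightarrow> int) \<Rightarrow> bool" where
  "ray_labelling p q l \<longleftrightarrow> (\<forall>x\<ge>1. leaf_at q x \<longrightarrow>
     (\<forall>w. desc p w (Suc x) \<longrightarrow> p w = p (Suc x) - 1 \<longrightarrow> l x = q w - 1))"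

section \<open>Ray labels of a synchronized pair form a decoration\<close>

locale ray_labelled_pair =
  fixes n :: nat and p q l :: "nat \<Rightarrow> int"
  assumes sync: "sync_seqs n p q" and ray: "ray_labelling p q l"
begin

lemma p: "depth_seq n p" and q: "depth_seq n q"
  and sub: "desc p i j \<Longrightarrow> desc q i j" and lf: "1 \<le> i \<Longrightarrow> leaf_at p i \<longleftrightarrow> leaf_at q i"
  using sync by (auto simp: sync_seqs_def)

lemma label_parent:
  assumes "1 \<le> x" "leaf_at q x"
  obtains w where "w < x" "desc p w (Suc x)" "p w = p (Suc x) - 1" "l x = q w - 1"
proof -
  obtain w where w: "w \<le> x" "desc p w (Suc x)" "p w = p (Suc x) - 1"
    using parent_exists[OF p] by blast
  have "w \<noteq> x" using lf[OF assms(1)] assms(2) w by auto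
  then show ?thesis using that[of w] w ray assms by (auto simp: ray_labelling_def)
qed

lemma label_ge:
  assumes "1 \<le> x" "leaf_at q x" "v \<le> x" "desc p v (Suc x)"
  shows "q v - 1 \<le> l x"
proof -
  obtain w where w: "w < x" "desc p w (Suc x)" "p w = p (Suc x) - 1" "l x = q w - 1"
    using label_parent[OF assms(1,2)] by blast
  have "desc q v w" using desc_via_parent[OF w(2,3) assms(4,3)] by (rule sub)
  then show ?thesis using w(4) desc_depth_le by fastforce
qed

text \<open>If the subtree of \<open>v\<close> in \<open>p\<close> ends at \<open>x\<close>, the
  parent of \<open>Suc x\<close> is a proper ancestor of \<open>v\<close>. It remains one in
  \<open>q\<close>, so its depth there is strictly smaller.\<close>

lemma label_le:
  assumes "1 \<le> x" "leaf_at q x" "desc p v x" "\<not> desc p v (Suc x)"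
  shows "l x \<le> q v - 2"
proof -
  obtain w where w: "w < x" "desc p w (Suc x)" "p w = p (Suc x) - 1" "l x = q w - 1"
    using label_parent[OF assms(1,2)] by blast
  have vx: "v \<le> x" using assms(3) by (simp add: desc_def)
  have "w < v"
  proof (rule ccontr)
    assume "\<not> w < v"
    then have "desc p v w" using desc_between[OF assms(3)] w(1) by simp
    then show False using desc_trans[OF _ w(2)] assms(4) by blast
  qed
  moreover have "desc q w v" using sub desc_between[OF w(2), of v] \<open>w < v\<close> vx by simp
  ultimately show ?thesis using desc_less[of q w v] w(4) by simp
qed

lemma last_is_leaf:
  assumes "1 \<le> v" "desc p v x" "\<not> desc p v (Suc x)"
  shows "leaf_at q x"
proof -
  have "p (Suc x) \<le> p v" using assms by (auto simp: desc_Suc)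
  moreover have "p v \<le> p x" using assms desc_depth_le by blast
  moreover have "1 \<le> x" using assms by (auto simp: desc_def)
  ultimately show ?thesis using lf[of x] by simp
qed

lemma first_low_of_last:
  assumes "1 \<le> v" "desc p v x" "\<not> desc p v (Suc x)"
  shows "first_low q l v x"
  unfolding first_low_def
proof (intro conjI allI impI)
  have x: "1 \<le> x" using assms by (auto simp: desc_def)
  show "leaf_at q x" using last_is_leaf[OF assms] .
  then show "l x \<le> q v - 2" using label_le[OF x _ assms(2,3)] by simp
  show "desc q v x" using sub assms by blast
  fix y assume y: "y < x" "leaf_at q y" "desc q v y"
  then have "desc p v (Suc y)" using desc_between[OF assms(2), of "Suc y"] by (simp add: desc_def)
  then show "q v - 2 < l y" using label_ge[of y v] y assms(1) desc_le[OF y(3)] by simp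
qed

text \<open>A vertex has at most one first low leaf, and its last descendant in \<open>p\<close> is
  one.\<close>

lemma first_low_iff_last:
  assumes "1 \<le> v"
  shows "first_low q l v x \<longleftrightarrow> desc p v x \<and> \<not> desc p v (Suc x)"
proof
  assume x: "first_low q l v x"
  obtain z where z: "desc p v z" "\<not> desc p v (Suc z)"
    using last_descendant_exists[OF p assms] by blast
  have "first_low q l v z" using first_low_of_last[OF assms z] .
  with x have "\<not> x < z" "\<not> z < x" by (auto simp: first_low_def)
  then have "x = z" by simp
  with z show "desc p v x \<and> \<not> desc p v (Suc x)" by simp
qed (use first_low_of_last[OF assms] in blast)

lemma decoration_of_sync: "decoration q l"
  unfolding decoration_def
proof (intro conjI allI impI)
  fix x :: nat assume x: "1 \<le> x" "leaf_at q x"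
  obtain w where w: "w < x" "desc p w (Suc x)" "p w = p (Suc x) - 1" "l x = q w - 1"
    using label_parent[OF x] by blast
  show "-1 \<le> l x" using w depth_seq_nonneg[OF q, of w] by simp
  have "q w < q x" using sub[OF w(2)] w(1) by (simp add: desc_def)
  then show "l x \<le> q x - 2" using w by simp
next
  fix v :: nat assume v: "1 \<le> v"
  obtain z where z: "desc p v z" "\<not> desc p v (Suc z)"
    using last_descendant_exists[OF p v] by blast
  then show "\<exists>x. leaf_at q x \<and> desc q v x \<and> l x \<le> q v - 2"
    using first_low_of_last[OF v z] by (auto simp: first_low_def)
next
  fix v x y :: nat
  assume a: "1 \<le> v" "leaf_at q x" "leaf_at q y" "desc q v x" "desc q v y" "l x = q v - 1" "y < x"
  have x: "1 \<le> x" using a desc_le[of q v x] by simp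
  obtain w where w: "w < x" "desc p w (Suc x)" "p w = p (Suc x) - 1" "l x = q w - 1"
    using label_parent[OF x a(2)] by blast
  have "desc q w x" using sub desc_between[OF w(2), of x] w(1) by simp
  \<comment> \<open>Both are ancestors of \<open>x\<close> in \<open>q\<close> at depth
    \<open>l x + 1\<close>. So in \<open>p\<close> the subtree of \<open>v\<close> reaches beyond
    \<open>x\<close>, and it contains \<open>Suc y\<close> for each earlier leaf \<open>y\<close>
    below \<open>v\<close>.\<close>
  then have "w = v" using desc_eq_depth[of q w x v] a w by simp
  then have "desc p v (Suc y)" using w desc_between[OF w(2), of "Suc y"] a desc_le[OF a(5)] by simp
  then show "q v - 1 \<le> l y" using label_ge[of y v] a desc_le[OF a(5)] by simp
qed

end

text \<open>A bracketing \<open>f\<close> sends each vertex to its last descendant; laminarity says that the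
  intervals \<open>{v..f v}\<close> are nested or disjoint.\<close>

definition bracket_depth :: "(nat \<Rightarrow> nat) \<Rightarrow> nat \<Rightarrow> int" where
  "bracket_depth f x = (case x of 0 \<Rightarrow> 0 | Suc k \<Rightarrow> 1 + int (card {v. 1 \<le> v \<and> v \<le> k \<and> k < f v}))"

text \<open>Inside the bracket of \<open>v\<close>, all brackets around \<open>v\<close> are still
  open by laminarity and that of \<open>v\<close> is added, so the depth is larger. Just behind
  \<open>f v\<close>, an open bracket must have started before \<open>v\<close>, hence surrounds
  \<open>v\<close>, and the depth is back to at most that of \<open>v\<close>.\<close>

lemma desc_bracket_depth:
  assumes ge: "\<And>v. 1 \<le> v \<Longrightarrow> v \<le> f v"
    and laminar: "\<And>v w. 1 \<le> v \<Longrightarrow> v \<le> w \<Longrightarrow> w \<le> f v \<Longrightarrow> f w \<le> f v"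
    and v: "1 \<le> v"
  shows "desc (bracket_depth f) v x \<longleftrightarrow> v \<le> x \<and> x \<le> f v"
proof -
  let ?A = "\<lambda>k. {w. 1 \<le> w \<and> w < k \<and> k \<le> f w}"
  have fin: "finite (?A k)" for k by (rule finite_subset[of _ "{..<k}"]) auto
  have d: "bracket_depth f k = 1 + int (card (?A k))" if k: "1 \<le> k" for k
  proof -
    obtain j where "k = Suc j" using k by (cases k) auto
    then show ?thesis by (simp add: bracket_depth_def less_Suc_eq_le Suc_le_eq)
  qed
  have up: "bracket_depth f v < bracket_depth f k" if k: "v < k" "k \<le> f v" for k
  proof -
    have "insert v (?A v) \<subseteq> ?A k"
    proof
      fix w assume w: "w \<in> insert v (?A v)"
      show "w \<in> ?A k"
      proof (cases "w = v")
        case False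
        then have "f v \<le> f w" using laminar[of w v] w by simp
        then show ?thesis using w False k by simp
      qed (use v k in simp)
    qed
    then have "card (insert v (?A v)) \<le> card (?A k)" using fin card_mono by blast
    then show ?thesis using d[of v] d[of k] fin[of v] v k by simp
  qed
  have down: "bracket_depth f (Suc (f v)) \<le> bracket_depth f v"
  proof -
    have "?A (Suc (f v)) \<subseteq> ?A v"
    proof
      fix w assume w: "w \<in> ?A (Suc (f v))"
      have "w < v" using laminar[OF v, of w] w by (force simp: not_less)
      then show "w \<in> ?A v" using w ge[OF v] by auto
    qed
    then have "card (?A (Suc (f v))) \<le> card (?A v)" using fin card_mono by blast
    then show ?thesis using d[of v] d[of "Suc (f v)"] v by simp
  qed
  show ?thesis
  proof
    assume x: "desc (bracket_depth f) v x"
    have "x \<le> f v"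
    proof (rule ccontr)
      assume "\<not> x \<le> f v"
      then have "bracket_depth f v < bracket_depth f (Suc (f v))"
        using x ge[OF v] by (simp add: desc_def)
      then show False using down by simp
    qed
    then show "v \<le> x \<and> x \<le> f v" using desc_le[OF x] by simp
  qed (use up in \<open>auto simp: desc_def\<close>)
qed

lemma depth_seq_bracket_depth:
  assumes "\<And>v. 1 \<le> v \<Longrightarrow> v < f v \<Longrightarrow> f v \<le> n"
  shows "depth_seq n (bracket_depth f)"
  unfolding depth_seq_def
proof (intro conjI allI impI)
  show "bracket_depth f 0 = 0" by (simp add: bracket_depth_def)
  fix i
  show "1 \<le> bracket_depth f (Suc i)" by (simp add: bracket_depth_def)
  show "bracket_depth f (Suc i) \<le> bracket_depth f i + 1"
  proof (cases i)
    case (Suc j)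
    let ?B = "{v. 1 \<le> v \<and> v \<le> j \<and> j < f v}"
    have fin: "finite ?B" by (rule finite_subset[of _ "{..j}"]) auto
    \<comment> \<open>From \<open>i\<close> to \<open>Suc i\<close>, only the bracket that starts at
      \<open>i\<close> can be new.\<close>
    have "{v. 1 \<le> v \<and> v \<le> i \<and> i < f v} \<subseteq> insert i ?B" using Suc by auto
    then have "card {v. 1 \<le> v \<and> v \<le> i \<and> i < f v} \<le> card (insert i ?B)"
      using fin by (intro card_mono) auto
    also have "\<dots> \<le> Suc (card ?B)" using fin by (simp add: card_insert_if)
    finally show ?thesis using Suc by (simp add: bracket_depth_def)
  qed (simp add: bracket_depth_def)
next
  fix i assume i: "n < i"
  then obtain k where k: "i = Suc k" by (cases i) auto
  have "{v. 1 \<le> v \<and> v \<le> k \<and> k < f v} = {}" using assms i k by fastforce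
  then show "bracket_depth f i = 1" using k by (simp add: bracket_depth_def)
qed

text \<open>Since the first low leaf of \<open>v\<close> has to become its last descendant in
  \<open>p\<close>, the sequence \<open>p\<close> is the depth function of the bracketing that sends
  \<open>v\<close> to this leaf.\<close>

lemma sync_of_decoration:
  assumes q: "depth_seq n q" and dec: "decoration q l"
  obtains p where "sync_seqs n p q" "ray_labelling p q l"
proof -
  define low where "low v x \<longleftrightarrow> leaf_at q x \<and> desc q v x \<and> l x \<le> q v - 2" for v x
  define f where "f v = (LEAST x. low v x)" for v
  have low: "low v (f v)" if "1 \<le> v" for v
  proof -
    have "\<exists>x. low v x" using dec that by (simp add: decoration_def low_def)
    then show ?thesis unfolding f_def by (rule LeastI_ex)
  qed
  have f_le: "f v \<le> x" if "low v x" for v x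
    unfolding f_def using that by (rule Least_le)
  have ge: "v \<le> f v" if "1 \<le> v" for v using low[OF that] desc_le by (auto simp: low_def)
  \<comment> \<open>If \<open>f w\<close> lay beyond \<open>f v\<close>, then \<open>f v\<close>
    would be a leaf below \<open>w\<close>, and it is low for \<open>w\<close> because
    \<open>w\<close> is at least as deep as \<open>v\<close>; this contradicts the choice of
    \<open>f w\<close>.\<close>
  have laminar: "f w \<le> f v" if v: "1 \<le> v" and w: "v \<le> w" "w \<le> f v" for v w
  proof (rule ccontr)
    assume *: "\<not> f w \<le> f v"
    have w1: "1 \<le> w" using v w by simp
    have lv: "leaf_at q (f v)" "desc q v (f v)" "l (f v) \<le> q v - 2"
      using low[OF v] by (auto simp: low_def)
    have "desc q w (f v)"
      using desc_between[of q w "f w" "f v"] low[OF w1] * w by (auto simp: low_def)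
    moreover have "q v \<le> q w" using desc_depth_le[OF desc_between[OF lv(2) w]] .
    ultimately have "low w (f v)" using lv by (simp add: low_def)
    then show False using f_le * by blast
  qed
  define p where "p = bracket_depth f"
  have dp: "desc p v x \<longleftrightarrow> v \<le> x \<and> x \<le> f v" if "1 \<le> v" for v x
    unfolding p_def using desc_bracket_depth[OF ge laminar that] by blast
  have p: "depth_seq n p" unfolding p_def
  proof (rule depth_seq_bracket_depth)
    fix v :: nat assume v: "1 \<le> v" "v < f v"
    then show "f v \<le> n" using desc_bounded[OF q v(1) _ v(2)] low[OF v(1)] by (simp add: low_def)
  qed
  have sub: "desc q i j" if "desc p i j" for i j
  proof (cases "i = 0")
    case True then show ?thesis using desc_root[OF q] by simp
  next
    case False
    then show ?thesis using that dp[of i j] low[of i] desc_between[of q i "f i" j]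
      by (auto simp: low_def)
  qed
  have lf: "leaf_at p i \<longleftrightarrow> leaf_at q i" if i: "1 \<le> i" for i
  proof -
    have "leaf_at p i \<longleftrightarrow> \<not> desc p i (Suc i)" by (simp add: desc_Suc not_less)
    also have "\<dots> \<longleftrightarrow> f i = i" using dp[OF i, of "Suc i"] ge[OF i] by auto
    also have "\<dots> \<longleftrightarrow> leaf_at q i"
    proof
      assume "leaf_at q i"
      then have "low i i" using dec i by (simp add: low_def decoration_def)
      then show "f i = i" using f_le ge[OF i] by (simp add: le_antisym)
    qed (use low[OF i] in \<open>auto simp: low_def\<close>)
    finally show ?thesis .
  qed
  have "l x = q w - 1" if x: "1 \<le> x" "leaf_at q x"
    and w: "desc p w (Suc x)" "p w = p (Suc x) - 1" for x w
  proof -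
    have wx: "w \<le> x" using w desc_le[OF w(1)] by (cases "w = Suc x") auto
    have dw: "desc q w x" using sub[OF desc_between[OF w(1), of x]] wx by simp
    \<comment> \<open>A label this small would close the bracket of \<open>w\<close> at
      \<open>x\<close> or earlier, but \<open>Suc x\<close> is in it. This gives the lower bound
      \<open>q w - 1\<close> for the label.\<close>
    have notlow: "\<not> l x \<le> q w - 2" if "w \<noteq> 0"
    proof
      assume "l x \<le> q w - 2"
      then have "low w x" using dw x by (simp add: low_def)
      then show False using f_le[of w x] dp[of w "Suc x"] w that by simp
    qed
    have bounds: "-1 \<le> l x" "l x \<le> q x - 2" using dec x by (auto simp: decoration_def)
    show ?thesis
    proof (cases "l x = -1")
      case True
      have "w = 0" using notlow depth_seq_pos[OF q, of w] True by (cases w) auto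
      then show ?thesis using True depth_seqD(1)[OF q] by simp
    next
      case False
      \<comment> \<open>The ancestor whose parent has depth \<open>l x\<close>: the only vertex
        above \<open>x\<close> in \<open>q\<close> that can be the sought parent. It remains to show
        that it is \<open>w\<close>.\<close>
      then obtain s where s: "desc q s x" "q s = l x + 1"
        using ancestor_of_depth[OF q, of "l x + 1" x] bounds by auto
      have s1: "1 \<le> s" using s False bounds depth_seqD(1)[OF q] by (cases s) auto
      \<comment> \<open>The leaf \<open>x\<close> is not low for \<open>s\<close>, its label being
        one too large. If the bracket had closed before \<open>x\<close>, condition (3) would forbid
        the low label at \<open>f s\<close>.\<close>
      have "x < f s"
      proof (rule ccontr)
        assume "\<not> x < f s"
        moreover have "f s \<noteq> x" using low[OF s1] s by (auto simp: low_def)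
        ultimately have fx: "f s < x" by simp
        have fs: "leaf_at q (f s)" "desc q s (f s)" "l (f s) \<le> q s - 2"
          using low[OF s1] by (simp_all add: low_def)
        have "q s - 1 \<le> l (f s)"
          using decoration_before[OF dec s1 x(2) fs(1) s(1) fs(2) _ fx] s(2) by simp
        then show False using fs(3) by simp
      qed
      then have "desc p s (Suc x)" using dp[OF s1] desc_le[OF s(1)] by simp
      then have sw: "desc p s w" using desc_via_parent[OF w] desc_le[OF s(1)] by simp
      have "w \<noteq> 0" using sw s1 desc_le[OF sw] by simp
      then have "\<not> q s < q w" using notlow s by simp
      then have "s = w" using desc_less[OF sub[OF sw]] by blast
      then show ?thesis using s by simp
    qed
  qed
  then show ?thesis using that[of p] p q sub lf by (auto simp: sync_seqs_def ray_labelling_def)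
qed

section \<open>Dyck words and their depth sequences\<close>

definition rise :: "step list \<Rightarrow> int" where
  "rise w = int (count_list w Up) - int (count_list w Down)"

lemma rise_simps [simp]:
  "rise [] = 0" "rise (Up # w) = rise w + 1" "rise (Down # w) = rise w - 1"
  "rise (u @ w) = rise u + rise w" "rise (replicate c Down) = - int c"
proof -
  have "count_list (replicate c Down) Up = 0 \<and> count_list (replicate c Down) Down = c"
    by (induction c) auto
  then show "rise (replicate c Down) = - int c" by (simp add: rise_def)
qed (auto simp: rise_def)

lemma height_rise: "height w k = rise (take k w)"
  by (simp add: height_def rise_def)

definition stays_nonneg :: "int \<Rightarrow> step list \<Rightarrow> bool" where
  "stays_nonneg h w \<longleftrightarrow> (\<forall>k\<le>length w. 0 \<le> h + rise (take k w))"

lemma all_le_Suc: "(\<forall>k\<le>Suc n. Q k) \<longleftrightarrow> Q 0 \<and> (\<forall>k\<le>n. Q (Suc k))"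
  by (metis Suc_le_mono not0_implies_Suc zero_le)

lemma stays_nonneg_simps [simp]:
  "stays_nonneg h [] \<longleftrightarrow> 0 \<le> h"
  "stays_nonneg h (Up # w) \<longleftrightarrow> 0 \<le> h \<and> stays_nonneg (h + 1) w"
  "stays_nonneg h (Down # w) \<longleftrightarrow> 0 \<le> h \<and> stays_nonneg (h - 1) w"
  by (simp_all add: stays_nonneg_def all_le_Suc algebra_simps)

lemma stays_nonneg_start: "stays_nonneg h w \<Longrightarrow> 0 \<le> h"
  by (auto simp: stays_nonneg_def)

lemma stays_nonneg_append [simp]:
  "stays_nonneg h (u @ w) \<longleftrightarrow> stays_nonneg h u \<and> stays_nonneg (h + rise u) w"
proof (induction u arbitrary: h)
  case Nil then show ?case using stays_nonneg_start by auto
next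
  case (Cons a u) then show ?case by (cases a) (auto simp: algebra_simps)
qed

lemma stays_nonneg_replicate: "stays_nonneg h (replicate c Down) \<longleftrightarrow> int c \<le> h"
  by (induction c arbitrary: h) auto

lemma stays_nonneg_mono: "stays_nonneg h w \<Longrightarrow> h \<le> h' \<Longrightarrow> stays_nonneg h' w"
  by (fastforce simp: stays_nonneg_def)

lemma dyck_iff: "w \<in> dyck n \<longleftrightarrow> count_list w Up = n \<and> rise w = 0 \<and> stays_nonneg 0 w"
  by (auto simp: dyck_def rise_def stays_nonneg_def height_def)

text \<open>First-passage decomposition. It cuts off the primitive block behind an up step, both for
  building covers and for splitting a Dyck word into a first subtree and a rest.\<close>

lemma first_descent:
  "0 \<le> h \<Longrightarrow> h + rise w < 0 \<Longrightarrow> \<exists>B C. w = B @ Down # C \<and> h + rise B = 0 \<and> stays_nonneg h B"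
proof (induction w arbitrary: h)
  case (Cons a w)
  show ?case
  proof (cases a)
    case Up
    then obtain B C where "w = B @ Down # C" "h + 1 + rise B = 0" "stays_nonneg (h + 1) B"
      using Cons.IH[of "h + 1"] Cons.prems by auto
    then show ?thesis using Up Cons.prems by (intro exI[of _ "Up # B"] exI[of _ C]) auto
  next
    case Down
    show ?thesis
    proof (cases "h = 0")
      case True then show ?thesis using Down by (intro exI[of _ "[]"] exI[of _ w]) auto
    next
      case False
      then obtain B C where "w = B @ Down # C" "h - 1 + rise B = 0" "stays_nonneg (h - 1) B"
        using Cons.IH[of "h - 1"] Cons.prems Down by auto
      then show ?thesis using Down Cons.prems by (intro exI[of _ "Down # B"] exI[of _ C]) auto
    qed
  qed
qed auto

fun up_heights :: "int \<Rightarrow> step list \<Rightarrow> int list" where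
  "up_heights h [] = []"
| "up_heights h (Up # w) = (h + 1) # up_heights (h + 1) w"
| "up_heights h (Down # w) = up_heights (h - 1) w"

lemma length_up_heights [simp]: "length (up_heights h w) = count_list w Up"
  by (induction h w rule: up_heights.induct) auto

lemma up_heights_append: "up_heights h (u @ w) = up_heights h u @ up_heights (h + rise u) w"
  by (induction h u rule: up_heights.induct) (auto simp: algebra_simps)

lemma up_heights_replicate [simp]: "up_heights h (replicate c Down) = []"
  by (induction c arbitrary: h) auto

lemma up_heights_shift: "up_heights (h + d) w = map ((+) d) (up_heights h w)"
proof (induction h w rule: up_heights.induct)
  case (2 h w)
  then show ?case by (simp add: algebra_simps)
next
  case (3 h w)
  then show ?case by (simp add: algebra_simps)
qed simp

lemma up_heights_hd: "up_heights h w \<noteq> [] \<Longrightarrow> hd (up_heights h w) \<le> h + 1"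
  by (induction h w rule: up_heights.induct) fastforce+

lemma up_heights_pos: "stays_nonneg h w \<Longrightarrow> x \<in> set (up_heights h w) \<Longrightarrow> 1 \<le> x"
  by (induction h w rule: up_heights.induct) auto

lemma up_heights_slope:
  "i < count_list w Up \<Longrightarrow> up_heights h w ! i \<le> (h # up_heights h w) ! i + 1"
proof (induction h w arbitrary: i rule: up_heights.induct)
  case (2 h w) then show ?case by (cases i) auto
next
  case (3 h w) then show ?case by (cases i) force+
qed simp

lemma rise_no_up: "up_heights h w = [] \<Longrightarrow> rise w = - int (length w)"
  by (induction h w rule: up_heights.induct) auto

text \<open>The final run of down steps leaves no trace in the up heights; equality of the rises
  accounts for it.\<close>

lemma up_heights_inj: "up_heights h w = up_heights h w' \<Longrightarrow> rise w = rise w' \<Longrightarrow> w = w'"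
proof (induction w arbitrary: h w')
  case Nil
  then show ?case using rise_no_up[of h w'] by auto
next
  case (Cons a w)
  show ?case
  proof (cases w')
    case Nil
    then show ?thesis using rise_no_up[of h "a # w"] Cons.prems by simp
  next
    case (Cons b v)
    \<comment> \<open>The first up step ends at \<open>h + 1\<close> if it comes at once, and at
      \<open>h\<close> or lower after a down step.\<close>
    have mixed: "up_heights h (Up # x) \<noteq> up_heights h (Down # y)" for x y
    proof
      assume e: "up_heights h (Up # x) = up_heights h (Down # y)"
      then have "hd (up_heights (h - 1) y) = h + 1" "up_heights (h - 1) y \<noteq> []"
        by (metis up_heights.simps(2,3) list.sel(1), metis up_heights.simps(2,3) list.distinct(1))
      then show False using up_heights_hd[of "h - 1" y] by simp
    qed
    have "a = b" using Cons.prems Cons mixed by (cases a; cases b) (simp_all, metis+)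
    then show ?thesis using Cons.IH[of _ v] Cons.prems Cons by (cases b) auto
  qed
qed

section \<open>Dyck words correspond to depth sequences\<close>

definition depths :: "step list \<Rightarrow> nat \<Rightarrow> int" where
  "depths w i = (if i \<le> count_list w Up then (0 # up_heights 0 w) ! i else 1)"

lemma depth_seq_depths:
  assumes "w \<in> dyck n" shows "depth_seq n (depths w)"
  unfolding depth_seq_def
proof (intro conjI allI impI)
  have n: "count_list w Up = n" and nn: "stays_nonneg 0 w" using assms by (auto simp: dyck_iff)
  show "depths w 0 = 0" by (simp add: depths_def)
  have pos: "1 \<le> depths w (Suc i)" for i
    using up_heights_pos[OF nn, of "up_heights 0 w ! i"] by (auto simp: depths_def)
  then show "1 \<le> depths w (Suc i)" for i .
  have "0 \<le> depths w i" for i using pos[of "i - 1"] by (cases i) (auto simp: depths_def)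
  then show "depths w (Suc i) \<le> depths w i + 1" for i
    using up_heights_slope[of i w 0] by (auto simp: depths_def)
  show "depths w i = 1" if "n < i" for i using that n by (simp add: depths_def)
qed

lemma depths_inj:
  assumes "w \<in> dyck n" "w' \<in> dyck n" "depths w = depths w'" shows "w = w'"
proof -
  have "up_heights 0 w ! i = up_heights 0 w' ! i" if "i < n" for i
    using fun_cong[OF assms(3), of "Suc i"] that assms(1,2) by (simp add: depths_def dyck_iff)
  then have "up_heights 0 w = up_heights 0 w'"
    using assms by (intro nth_equalityI) (auto simp: dyck_iff)
  then show ?thesis using assms by (auto simp: dyck_iff intro: up_heights_inj)
qed

text \<open>Up step \<open>i\<close> ends at height \<open>p i\<close> and the next one starts at
  \<open>p (Suc i) - 1\<close>; the difference is the number of down steps between them. The list of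
  indices lets prefixes and suffixes of a word be named separately.\<close>

definition runs :: "(nat \<Rightarrow> int) \<Rightarrow> nat list \<Rightarrow> step list" where
  "runs p is = concat (map (\<lambda>i. Up # replicate (nat (p i + 1 - p (Suc i))) Down) is)"

definition word :: "nat \<Rightarrow> (nat \<Rightarrow> int) \<Rightarrow> step list" where
  "word n p = runs p [1..<Suc n]"

lemma runs_simps: "runs p [] = []"
  "runs p (i # is) = Up # replicate (nat (p i + 1 - p (Suc i))) Down @ runs p is"
  "runs p (is @ js) = runs p is @ runs p js"
  by (simp_all add: runs_def)

lemma word_0 [simp]: "word 0 p = []"
  by (simp add: word_def runs_simps)

lemma word_Suc:
  "word (Suc m) p = word m p @ Up # replicate (nat (p (Suc m) + 1 - p (Suc (Suc m)))) Down"
proof -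
  have "[1..<Suc (Suc m)] = [1..<Suc m] @ [Suc m]" by simp
  then show ?thesis by (simp add: word_def runs_simps del: upt_Suc)
qed

text \<open>A prefix \<open>word m p\<close> includes the run after its last up step, so it ends
  where up step \<open>Suc m\<close> starts. For \<open>m = n\<close> the continuation
  \<open>p (Suc n) = 1\<close> brings the path back to height 0.\<close>

lemma word_facts:
  assumes p: "depth_seq n p"
  shows "up_heights 0 (word m p) = map p [1..<Suc m] \<and> rise (word m p) = p (Suc m) - 1 \<and>
    stays_nonneg 0 (word m p)"
proof (induction m)
  case 0
  then show ?case using depth_seqD(1)[OF p] depth_seqD(2,3)[OF p, of 0] by simp
next
  case (Suc m)
  have b: "1 \<le> p (Suc m)" "p (Suc (Suc m)) \<le> p (Suc m) + 1" "1 \<le> p (Suc (Suc m))"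
    using depth_seqD(2,3)[OF p] by auto
  show ?case using Suc b
    by (simp add: word_Suc up_heights_append stays_nonneg_replicate)
qed

lemma word_dyck:
  assumes "depth_seq n p" shows "word n p \<in> dyck n" "depths (word n p) = p"
proof -
  have f: "up_heights 0 (word n p) = map p [1..<Suc n]" "rise (word n p) = p (Suc n) - 1"
    "stays_nonneg 0 (word n p)" using word_facts[OF assms, of n] by auto
  have c: "count_list (word n p) Up = n" using arg_cong[OF f(1), of length] by simp
  show "word n p \<in> dyck n" using f c depth_seqD(4)[OF assms, of "Suc n"] by (simp add: dyck_iff)
  show "depths (word n p) = p"
  proof
    fix i
    show "depths (word n p) i = p i"
    proof (cases "i \<le> n")
      case True
      then show ?thesis unfolding depths_def f(1) c using depth_seqD(1)[OF assms]
        by (cases i) (auto simp del: upt_Suc)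
    next
      case False
      then show ?thesis unfolding depths_def c using depth_seqD(4)[OF assms, of i] by simp
    qed
  qed
qed

lemma word_depths: "w \<in> dyck n \<Longrightarrow> word n (depths w) = w"
  using depths_inj word_dyck depth_seq_depths by blast

lemma word_append: "m \<le> n \<Longrightarrow> word n p = word m p @ runs p [Suc m..<Suc n]"
  using upt_add_eq_append[of 1 "Suc m" "n - m"] by (simp add: word_def runs_simps(3) del: upt_Suc)

lemma length_word_strict_mono: "a < b \<Longrightarrow> length (word a p) < length (word b p)"
  by (induction b) (auto simp: word_Suc less_Suc_eq simp del: upt_Suc)

lemma length_word_mono: "a \<le> b \<Longrightarrow> length (word a p) \<le> length (word b p)"
  using length_word_strict_mono[of a b p] by (cases "a = b") auto

lemma up_positions_append:
  "up_positions (u @ w) = up_positions u @ map ((+) (length u)) (up_positions w)"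
proof -
  have "[0..<length (u @ w)] = [0..<length u] @ map ((+) (length u)) [0..<length w]"
    using upt_add_eq_append[of 0 "length u" "length w"] map_add_upt[of "length u" "length w"]
    by (simp add: add.commute[of _ "length u"])
  moreover have "filter (\<lambda>i. (u @ w) ! i = Up) [0..<length u] = up_positions u"
    unfolding up_positions_def by (rule filter_cong) (auto simp: nth_append)
  ultimately show ?thesis by (simp add: up_positions_def filter_map o_def)
qed

lemma up_positions_word: "up_positions (word n p) = map (\<lambda>i. length (word (i - 1) p)) [1..<Suc n]"
proof (induction n)
  case 0 then show ?case by (simp add: up_positions_def)
next
  case (Suc n)
  have e: "[1..<Suc (Suc n)] = [1..<Suc n] @ [Suc n]" by simp
  have "up_positions [Up] = [0]" by (simp add: up_positions_def)
  moreover have "up_positions (replicate c Down) = []" for c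
    by (simp add: up_positions_def filter_empty_conv)
  ultimately have "up_positions (Up # replicate c Down) = [0]" for c
    using up_positions_append[of "[Up]" "replicate c Down"] by simp
  then show ?case using Suc
    by (subst e, subst map_append, subst word_Suc) (simp add: up_positions_append del: upt_Suc)
qed

lemma word_nth_after_up:
  assumes p: "depth_seq n p" and i: "1 \<le> i" "i \<le> n" and
    bound: "Suc (length (word (i - 1) p)) < length (word n p)"
  shows "word n p ! Suc (length (word (i - 1) p)) = Up \<longleftrightarrow> \<not> leaf_at p i"
proof -
  obtain j where j: "i = Suc j" using i by (cases i) auto
  define R where "R = runs p [Suc i..<Suc n]"
  have w: "word n p = word j p @ Up # replicate (nat (p i + 1 - p (Suc i))) Down @ R"
    using word_append[OF i(2), of p] word_Suc[of j p] j by (simp add: R_def del: upt_Suc)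
  show ?thesis
  proof (cases "leaf_at p i")
    case True
    then obtain c where "nat (p i + 1 - p (Suc i)) = Suc c"
      by (metis gr0_conv_Suc zero_less_nat_eq add.commute diff_gt_0_iff_gt zle_add1_eq_le)
    then show ?thesis using True w j by (simp add: nth_append del: upt_Suc)
  next
    case False
    then have "nat (p i + 1 - p (Suc i)) = 0" using depth_seqD(3)[OF p, of i] by simp
    moreover from this have "R \<noteq> []" using bound w j by (auto simp del: upt_Suc)
    then have "R ! 0 = Up"
      using upt_conv_Cons[of "Suc i" "Suc n"]
      by (cases "i < n") (simp_all add: R_def runs_simps del: upt_Suc)
    ultimately show ?thesis using False w j by (simp add: nth_append del: upt_Suc)
  qed
qed

lemma path_type_word:
  assumes p: "depth_seq n p"
  shows "path_type (word n p) = map (\<lambda>i. if leaf_at p i then N else E) [1..<n]"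
proof (cases n)
  case 0 then show ?thesis by (simp add: path_type_def up_positions_def)
next
  case (Suc m)
  then have "butlast (up_positions (word n p)) = map (\<lambda>i. length (word (i - 1) p)) [1..<n]"
    unfolding up_positions_word by (simp add: map_butlast[symmetric] del: upt_Suc) (simp add: butlast_append)
  then show ?thesis unfolding path_type_def
  proof (simp del: upt_Suc, intro ballI)
    fix i assume i: "i \<in> {Suc 0..<n}"
    have "Suc (length (word (i - 1) p)) \<le> length (word i p)"
      using length_word_strict_mono[of "i - 1" i p] i by simp
    also have "\<dots> < length (word n p)" using length_word_strict_mono[of i n p] i by simp
    finally show "(word n p ! Suc (length (word (i - Suc 0) p)) = Up \<longrightarrow> \<not> leaf_at p i) \<and>
       (word n p ! Suc (length (word (i - Suc 0) p)) \<noteq> Up \<longrightarrow> leaf_at p i)"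
      using word_nth_after_up[OF p, of i] i by (simp del: upt_Suc)
  qed
qed

text \<open>Types inspect only the up steps before the last one, but from \<open>n\<close> on every
  position is a leaf in both sequences, because the next depth is 1.\<close>

lemma path_type_eq_iff:
  assumes p: "depth_seq n p" and q: "depth_seq n q"
  shows "path_type (word n p) = path_type (word n q) \<longleftrightarrow> (\<forall>i\<ge>1. leaf_at p i \<longleftrightarrow> leaf_at q i)"
proof -
  have end_leaf: "leaf_at r i" if "depth_seq n r" "1 \<le> i" "n \<le> i" for r i
    using that depth_seqD(4)[OF that(1), of "Suc i"] depth_seq_pos[OF that(1,2)] by simp
  have "path_type (word n p) = path_type (word n q) \<longleftrightarrow>
      (\<forall>i\<in>{1..<n}. leaf_at p i \<longleftrightarrow> leaf_at q i)"
    unfolding path_type_word[OF p] path_type_word[OF q] by auto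
  also have "\<dots> \<longleftrightarrow> (\<forall>i\<ge>1. leaf_at p i \<longleftrightarrow> leaf_at q i)"
    using end_leaf[OF p] end_leaf[OF q] by (metis atLeastLessThan_iff not_le)
  finally show ?thesis .
qed

text \<open>The ray runs at height \<open>p (Suc i) - 1\<close>, the depth of the parent
  \<open>v\<close> of \<open>Suc i\<close>. All up steps after \<open>v\<close> up to
  \<open>i\<close> end higher, so none of them is hit, and the end of up step \<open>v\<close> is
  the rightmost candidate.\<close>

lemma ray_label_word:
  assumes p: "depth_seq n p" and i: "1 \<le> i" "i \<le> n" and lf: "leaf_at p i"
    and v: "desc p v (Suc i)" "p v = p (Suc i) - 1"
  shows "ray_label (word n p) T i = (if v = 0 then -1 else depth (butlast (traversal T ! v)))"
proof -
  let ?P = "word n p"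
  define pt where "pt j = length (word (j - 1) p)" for j
  have pos: "up_positions ?P ! (j - 1) = pt j" if "1 \<le> j" "j \<le> n" for j
    unfolding up_positions_word pt_def using that nth_upt[of 1 "j - 1" "Suc n"] by (simp del: upt_Suc)
  have split: "?P = word (j - 1) p @ Up # replicate (nat (p j + 1 - p (Suc j))) Down @ runs p [Suc j..<Suc n]"
    if "1 \<le> j" "j \<le> n" for j
    using word_append[OF that(2), of p] word_Suc[of "j - 1" p] that by (simp del: upt_Suc)
  have R: "takeWhile (\<lambda>s. s = Down) (runs p [Suc i..<Suc n]) = []"
    by (cases "i < n") (simp_all add: upt_conv_Cons runs_simps del: upt_Suc)
  have "run_end ?P i = length (word i p)"
  proof -
    have "drop (pt i + 1) ?P = replicate (nat (p i + 1 - p (Suc i))) Down @ runs p [Suc i..<Suc n]"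
      using split[OF i] by (simp add: pt_def del: upt_Suc)
    then have "run_end ?P i = pt i + 1 + nat (p i + 1 - p (Suc i))"
      unfolding run_end_def Let_def pos[OF i] using R
      by (simp add: takeWhile_append del: upt_Suc)
    then show ?thesis using word_Suc[of "i - 1" p] i by (simp add: pt_def del: upt_Suc)
  qed
  moreover have "height ?P (length (word i p)) = p (Suc i) - 1"
    using word_append[OF i(2), of p] word_facts[OF p, of i] by (simp add: height_rise del: upt_Suc)
  ultimately have H: "ray_hits ?P (run_end ?P i) =
      {k. 0 < k \<and> k < length (word i p) \<and> height ?P k = p (Suc i) - 1 \<and> ?P ! (k - 1) = Up \<and> ?P ! k = Up}"
    by (simp add: ray_hits_def del: upt_Suc)
  have at: "height ?P (Suc (pt j)) = p j" "count_list (take (Suc (pt j)) ?P) Up = j" "?P ! pt j = Up"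
    if "1 \<le> j" "j \<le> n" for j
  proof -
    have t: "take (Suc (pt j)) ?P = word (j - 1) p @ [Up]"
      using split[OF that] by (simp add: pt_def del: upt_Suc)
    have f: "rise (word (j - 1) p) = p j - 1" "length (up_heights 0 (word (j - 1) p)) = j - 1"
      using word_facts[OF p, of "j - 1"] that by (simp_all del: length_up_heights)
    show "height ?P (Suc (pt j)) = p j" "count_list (take (Suc (pt j)) ?P) Up = j"
      unfolding height_rise t using f that by (simp_all del: upt_Suc)
    show "?P ! pt j = Up" using split[OF that] by (simp add: pt_def nth_append del: upt_Suc)
  qed
  have hit: "\<exists>j. 1 \<le> j \<and> j \<le> i \<and> k = Suc (pt j) \<and> p j = p (Suc i) - 1"
    if k: "k \<in> ray_hits ?P (run_end ?P i)" for k
  proof -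
    have k': "0 < k" "k < length (word i p)" "height ?P k = p (Suc i) - 1" "?P ! (k - 1) = Up"
      using k unfolding H by auto
    have "k - 1 < length ?P" using k' length_word_mono[OF i(2), of p] by simp
    then have "k - 1 \<in> set (up_positions ?P)" using k' by (simp add: up_positions_def)
    then obtain j where j: "1 \<le> j" "j \<le> n" "k - 1 = pt j"
      unfolding up_positions_word pt_def by (auto simp del: upt_Suc)
    have kj: "k = Suc (pt j)" using j k' by simp
    have "j \<le> i"
    proof (rule ccontr)
      assume "\<not> j \<le> i"
      then have "length (word i p) \<le> pt j" unfolding pt_def by (intro length_word_mono) simp
      then show False using k' kj by simp
    qed
    then show ?thesis using j kj at(1)[OF j(1,2)] k' by auto
  qed
  show ?thesis
  proof (cases "v = 0")
    case True
    have "ray_hits ?P (run_end ?P i) = {}"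
    proof (rule ccontr)
      assume "ray_hits ?P (run_end ?P i) \<noteq> {}"
      \<comment> \<open>With the root as parent the ray runs at height 0, where no up step
        ends.\<close>
      then obtain j where "1 \<le> j" "p j = p (Suc i) - 1" using hit by blast
      then show False using depth_seq_pos[OF p, of j] v True depth_seqD(1)[OF p] by simp
    qed
    then show ?thesis using True by (simp add: ray_label_def del: upt_Suc)
  next
    case False
    have vi: "v < i"
      using v lf desc_le[OF v(1)] by (cases "v = i"; cases "v = Suc i") auto
    have v1: "1 \<le> v" "v \<le> n" using False vi i by auto
    have lt: "Suc (pt v) < length (word i p)"
    proof -
      have "Suc (pt v) \<le> length (word v p)"
        unfolding pt_def using length_word_strict_mono[of "v - 1" v p] v1 by simp
      then show ?thesis using length_word_strict_mono[OF vi, of p] by simp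
    qed
    \<comment> \<open>As \<open>i\<close> is a leaf, \<open>v\<close> comes before \<open>i\<close>
      and has a child. Its up step is thus followed by another one, as a hit requires.\<close>
    have "\<not> leaf_at p v" using v vi by (auto simp: desc_def)
    then have "?P ! Suc (pt v) = Up"
      using word_nth_after_up[OF p v1] lt length_word_mono[OF i(2), of p] by (simp add: pt_def)
    then have "Suc (pt v) \<in> ray_hits ?P (run_end ?P i)"
      unfolding H using lt at[OF v1] v by simp
    moreover have "k \<le> Suc (pt v)" if k: "k \<in> ray_hits ?P (run_end ?P i)" for k
    proof -
      obtain j where j: "1 \<le> j" "j \<le> i" "k = Suc (pt j)" "p j = p (Suc i) - 1" using hit[OF k] by blast
      have "j \<le> v"
      proof (rule ccontr)
        assume "\<not> j \<le> v"
        then have "p v < p j" using v(1) j(2) by (simp add: desc_def)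
        then show False using j v by simp
      qed
      then have "pt j \<le> pt v" unfolding pt_def by (intro length_word_mono) simp
      then show ?thesis using j by simp
    qed
    moreover have "finite (ray_hits ?P (run_end ?P i))"
      by (rule finite_subset[of _ "{..<length (word i p)}"]) (auto simp: H simp del: upt_Suc)
    ultimately have "Max (ray_hits ?P (run_end ?P i)) = Suc (pt v)" by (intro Max_eqI) auto
    then show ?thesis
      using False at(2)[OF v1] \<open>Suc (pt v) \<in> ray_hits ?P (run_end ?P i)\<close>
      by (auto simp: ray_label_def Let_def simp del: upt_Suc)
  qed
qed

section \<open>The Tamari order on words\<close>

lemma primitive_dyck_iff:
  "primitive_dyck V \<longleftrightarrow> (\<exists>B. V = Up # B @ [Down] \<and> rise B = 0 \<and> stays_nonneg 0 B)"
proof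
  assume V: "primitive_dyck V"
  then obtain B m where B: "V = Up # B @ [Down]" and m: "V \<in> dyck m" by (auto simp: primitive_dyck_def)
  have "0 \<le> rise (take k B)" if k: "k \<le> length B" for k
  proof -
    have "height V (Suc k) \<noteq> 0" using V B k by (simp add: primitive_dyck_def)
    moreover have "0 \<le> height V (Suc k)" using m B k by (simp add: dyck_def)
    moreover have "height V (Suc k) = 1 + rise (take k B)" using B k by (simp add: height_rise)
    ultimately show ?thesis by simp
  qed
  then show "\<exists>B. V = Up # B @ [Down] \<and> rise B = 0 \<and> stays_nonneg 0 B"
    using B m by (auto simp: stays_nonneg_def dyck_iff)
next
  assume "\<exists>B. V = Up # B @ [Down] \<and> rise B = 0 \<and> stays_nonneg 0 B"
  then obtain B where B: "V = Up # B @ [Down]" "rise B = 0" "stays_nonneg 0 B" by blast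
  have "height V k \<noteq> 0" if k: "0 < k" "k < length V" for k
  proof -
    obtain j where j: "k = Suc j" "j \<le> length B" using k B by (cases k) auto
    then have "height V k = 1 + rise (take j B)" using B by (simp add: height_rise)
    moreover have "0 \<le> rise (take j B)" using B j by (simp add: stays_nonneg_def)
    ultimately show ?thesis by simp
  qed
  moreover have "V \<in> dyck (count_list V Up)"
    using B stays_nonneg_mono[of 0 B 1] by (simp add: dyck_iff)
  ultimately show "primitive_dyck V" using B(1) by (auto simp: primitive_dyck_def)
qed

text \<open>Only \<open>V\<close> changes its starting height, from \<open>h - 1\<close> to
  \<open>h\<close>. Its first up step ends at \<open>h\<close> in \<open>P\<close> and its other
  ones higher, while the first up step of \<open>C\<close> starts at \<open>h - 1\<close>; so
  \<open>V\<close> is exactly a subtree.\<close>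

lemma cover_depths:
  assumes P: "P \<in> dyck n" "P = A @ [Down] @ V @ C" and V: "primitive_dyck V"
    and Q: "Q = A @ V @ [Down] @ C" and m: "m = count_list A Up"
  obtains m' where "Q \<in> dyck n" "depths Q = lift_step m m' (depths P)"
    "depths P (Suc m') \<le> depths P (Suc m)" "desc (depths P) (Suc m) m'"
proof -
  obtain B where B: "V = Up # B @ [Down]" "rise B = 0" "stays_nonneg 0 B"
    using V by (auto simp: primitive_dyck_iff)
  define h where "h = rise A"
  define m' where "m' = m + count_list V Up"
  have PV: "stays_nonneg 0 A" "1 \<le> h" "stays_nonneg (h - 1) V" "stays_nonneg (h - 1) C"
    "h - 1 + rise C = 0" "count_list A Up + count_list V Up + count_list C Up = n"
    using P B stays_nonneg_start[of "h - 1" V] by (auto simp: dyck_iff h_def)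
  have V0: "rise V = 0" using B by simp
  have "Q \<in> dyck n"
    using PV Q V0 stays_nonneg_mono[OF PV(3), of h] by (auto simp: dyck_iff h_def)
  moreover have uP: "up_heights 0 P = up_heights 0 A @ up_heights (h - 1) V @ up_heights (h - 1) C"
    using P(2) V0 by (simp add: up_heights_append h_def)
  have "up_heights 0 Q = up_heights 0 A @ map ((+) 1) (up_heights (h - 1) V) @ up_heights (h - 1) C"
    using Q V0 up_heights_shift[of "h - 1" 1 V] by (simp add: up_heights_append h_def)
  moreover have len: "count_list P Up = m + count_list V Up + count_list C Up"
    "count_list Q Up = m + count_list V Up + count_list C Up"
    using P(2) Q m by auto
  ultimately have dQ: "depths Q = lift_step m m' (depths P)"
    by (auto simp: fun_eq_iff depths_def lift_step_def uP m'_def nth_Cons' nth_append m)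
  have uV: "up_heights (h - 1) V = h # up_heights h B"
    using B by (simp add: up_heights_append)
  have dm: "depths P (Suc m) = h" using uV B m
    by (simp add: depths_def uP len nth_append)
  have "depths P (Suc m') \<le> h"
  proof (cases "count_list C Up = 0")
    case True
    then show ?thesis using PV(2) len by (simp add: depths_def m'_def)
  next
    case False
    then have ne: "up_heights (h - 1) C \<noteq> []" by (metis length_up_heights list.size(3))
    then have "depths P (Suc m') = hd (up_heights (h - 1) C)"
      using False by (simp add: depths_def uP len m'_def nth_append m hd_conv_nth)
    then show ?thesis using up_heights_hd[OF ne] by simp
  qed
  moreover have "desc (depths P) (Suc m) m'"
    unfolding desc_def
  proof (intro conjI allI impI)
    show "Suc m \<le> m'" using B by (simp add: m'_def)
    fix k assume k: "Suc m < k \<and> k \<le> m'"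
    then have "depths P k = up_heights (h - 1) V ! (k - Suc m)"
      using m by (auto simp: depths_def uP len m'_def nth_append nth_Cons')
    also have "\<dots> = up_heights h B ! (k - Suc (Suc m))"
      using k uV by (simp add: nth_Cons')
    also have "\<dots> = h + up_heights 0 B ! (k - Suc (Suc m))"
    proof -
      have "k - Suc (Suc m) < count_list B Up" using k B(1) by (auto simp: m'_def)
      then show ?thesis using up_heights_shift[of 0 h B] by simp
    qed
    finally have "depths P k = h + up_heights 0 B ! (k - Suc (Suc m))" .
    moreover have "up_heights 0 B ! (k - Suc (Suc m)) \<in> set (up_heights 0 B)"
      using k B(1) by (intro nth_mem) (auto simp: m'_def)
    ultimately show "depths P (Suc m) < depths P k"
      using up_heights_pos[OF B(3)] dm by fastforce
  qed
  ultimately show ?thesis using that \<open>Q \<in> dyck n\<close> dQ dm by simp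
qed

lemma tamari_le_desc: "tamari_le n P Q \<Longrightarrow> desc (depths P) i j \<Longrightarrow> desc (depths Q) i j"
  unfolding tamari_le_def
proof (induction rule: rtranclp_induct)
  case (step Y Z)
  obtain A V C where *: "Y \<in> dyck n" "Y = A @ [Down] @ V @ C" "primitive_dyck V" "Z = A @ V @ [Down] @ C"
    using step(2) by (auto simp: tamari_cover_def)
  show ?case
    by (rule cover_depths[OF * refl]) (use step lift_step_desc in auto)
qed

text \<open>Since \<open>m\<close> is a leaf, a down step immediately precedes up step
  \<open>Suc m\<close>. The block to exchange it with begins at this up step and ends at the first
  return.\<close>

lemma cover_exists:
  assumes P: "P \<in> dyck n" and m: "1 \<le> m" "m < n" "depths P (Suc m) \<le> depths P m"
  obtains Q m' where "tamari_cover n P Q" "Q \<in> dyck n" "depths Q = lift_step m m' (depths P)"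
    "depths P (Suc m') \<le> depths P (Suc m)" "desc (depths P) (Suc m) m'"
proof -
  define p where "p = depths P"
  have p: "depth_seq n p" and w: "P = word n p"
    using P depth_seq_depths word_depths by (auto simp: p_def)
  obtain c where c: "nat (p m + 1 - p (Suc m)) = Suc c"
    using m(3) unfolding p_def
    by (metis gr0_conv_Suc zero_less_nat_eq add.commute diff_gt_0_iff_gt zle_add1_eq_le)
  define A where "A = word (m - 1) p @ Up # replicate c Down"
  have A: "word m p = A @ [Down]"
    using word_Suc[of "m - 1" p] m(1) c by (simp add: A_def replicate_append_same del: replicate_Suc)
      (simp add: replicate_append_same[symmetric])
  obtain R where R: "runs p [Suc m..<Suc n] = Up # R"
    using m by (simp add: upt_conv_Cons runs_simps del: upt_Suc)
  have PR: "P = A @ [Down] @ Up # R" using w word_append[of m n p] m A R by simp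
  \<comment> \<open>The rest of the path descends from \<open>p (Suc m) >= 1\<close> to 0, so from
    the end of up step \<open>Suc m\<close> it does get below its own starting height.\<close>
  have "rise R = - p (Suc m)"
    using P PR A word_facts[OF p, of m] by (auto simp: dyck_iff)
  then have "0 + rise R < 0" using depth_seqD(2)[OF p, of m] by simp
  then obtain B C where BC: "R = B @ Down # C" "rise B = 0" "stays_nonneg 0 B"
    using first_descent[of 0 R] by auto
  define V where "V = Up # B @ [Down]"
  have V: "primitive_dyck V" using BC by (auto simp: primitive_dyck_iff V_def)
  have PV: "P = A @ [Down] @ V @ C" using PR BC by (simp add: V_def)
  have "length (up_heights 0 (word m p)) = m"
    using word_facts[OF p, of m] by (simp del: length_up_heights)
  then have mA: "m = count_list A Up" using A by simp
  have "tamari_cover n P (A @ V @ [Down] @ C)"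
    unfolding tamari_cover_def using P V PV by blast
  then show ?thesis using cover_depths[OF P PV V refl mA] that by blast
qed

lemma depth_seq_le: "depth_seq n p \<Longrightarrow> p i \<le> int i"
proof (induction i)
  case (Suc i) then show ?case using depth_seqD(3)[OF Suc.prems, of i] by simp
qed (simp add: depth_seqD(1))

text \<open>Greedy ascent: lift the subtree at the first difference while staying below
  \<open>Q\<close>. The measure sums the gaps between the depths and their maximum \<open>i\<close>,
  and each lift decreases it.\<close>

lemma tamari_le_of_desc:
  assumes Q: "Q \<in> dyck n"
  shows "P \<in> dyck n \<Longrightarrow> (\<And>i j. desc (depths P) i j \<Longrightarrow> desc (depths Q) i j) \<Longrightarrow> tamari_le n P Q"
proof (induction "nat (\<Sum>i\<le>n. int i - depths P i)" arbitrary: P rule: less_induct)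
  case (less P)
  show ?case
  proof (cases "depths P = depths Q")
    case True
    then have "P = Q" using depths_inj Q less.prems(1) by blast
    then show ?thesis by (simp add: tamari_le_def)
  next
    case False
    have p: "depth_seq n (depths P)" and q: "depth_seq n (depths Q)"
      using less.prems(1) Q depth_seq_depths by auto
    obtain m where m: "1 \<le> m" "m < n" "\<And>k. k \<le> m \<Longrightarrow> depths P k = depths Q k"
      "depths P (Suc m) < depths Q (Suc m)" "depths P (Suc m) \<le> depths P m"
      using first_difference[OF p q less.prems(2) False] by blast
    obtain Y m' where Y: "tamari_cover n P Y" "Y \<in> dyck n" "depths Y = lift_step m m' (depths P)"
      "depths P (Suc m') \<le> depths P (Suc m)" "desc (depths P) (Suc m) m'"
      using cover_exists[OF less.prems(1) m(1,2,5)] by blast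
    have sub: "desc (depths Q) i j" if "desc (depths Y) i j" for i j
      using lift_step_below[OF less.prems(2) m(3,4) Y(4,5)] that Y(3) by simp
    have "(\<Sum>i\<le>n. int i - depths Y i) < (\<Sum>i\<le>n. int i - depths P i)"
    proof (rule sum_strict_mono_ex1)
      show "\<forall>i\<in>{..n}. int i - depths Y i \<le> int i - depths P i"
        unfolding Y(3) by (simp add: lift_step_def)
      show "\<exists>i\<in>{..n}. int i - depths Y i < int i - depths P i"
        using m(2) desc_le[OF Y(5)] unfolding Y(3)
        by (intro bexI[of _ "Suc m"]) (auto simp: lift_step_def)
    qed simp
    moreover have "0 \<le> (\<Sum>i\<le>n. int i - depths Y i)"
      using depth_seq_le[OF depth_seq_depths[OF Y(2)]] by (intro sum_nonneg) simp
    ultimately have "tamari_le n Y Q" using less.hyps[of Y] Y(2) sub by simp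
    then show ?thesis using Y(1) unfolding tamari_le_def by (rule converse_rtranclp_into_rtranclp[rotated])
  qed
qed

lemma sync_intervals_iff:
  assumes "P \<in> dyck n" "Q \<in> dyck n"
  shows "(P, Q) \<in> sync_intervals n \<longleftrightarrow> sync_seqs n (depths P) (depths Q)"
proof -
  have d: "depth_seq n (depths P)" "depth_seq n (depths Q)" using assms depth_seq_depths by auto
  have "tamari_le n P Q \<longleftrightarrow> (\<forall>i j. desc (depths P) i j \<longrightarrow> desc (depths Q) i j)"
    using tamari_le_desc tamari_le_of_desc assms by blast
  then show ?thesis
    using assms d path_type_eq_iff[OF d] word_depths[OF assms(1)] word_depths[OF assms(2)]
    by (simp add: sync_intervals_def sync_seqs_def del: upt_Suc)
qed

section \<open>Plane trees and their depth sequences\<close>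

definition forest_contour :: "ptree list \<Rightarrow> step list" where
  "forest_contour ts = concat (map (\<lambda>t. Up # contour t @ [Down]) ts)"

lemma forest_contour_simps [simp]:
  "forest_contour [] = []"
  "forest_contour (t # ts) = Up # contour t @ Down # forest_contour ts"
  by (simp_all add: forest_contour_def)

lemma contour_Node: "contour (Node ts) = forest_contour ts"
  by (simp add: forest_contour_def)

declare contour.simps [simp del]

lemma contour_dyck: "contour t \<in> dyck (num_edges t)"
proof (induction t)
  case (Node ts)
  have "forest_contour us \<in> dyck (\<Sum>t\<leftarrow>us. 1 + num_edges t)" if "set us \<subseteq> set ts" for us
    using that
  proof (induction us)
    case (Cons u us)
    then have "contour u \<in> dyck (num_edges u)" using Node by simp
    then show ?case using Cons stays_nonneg_mono[of 0 "contour u" 1] by (auto simp: dyck_iff)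
  qed (simp add: dyck_iff)
  then show ?case by (simp add: contour_Node)
qed

text \<open>The remainders \<open>x\<close> and \<open>y\<close> start with a down step or are
  empty, which marks the end of the forest. With them the induction can enter a first subtree, whose
  contour is followed by its closing \<open>Down\<close>.\<close>

lemma forest_contour_inj:
  "forest_contour ts @ x = forest_contour us @ y \<Longrightarrow> x = [] \<or> hd x = Down \<Longrightarrow> y = [] \<or> hd y = Down \<Longrightarrow>
   ts = us \<and> x = y"
proof (induction "length (forest_contour ts)" arbitrary: ts us x y rule: less_induct)
  case less
  show ?case
  proof (cases ts)
    case Nil
    then show ?thesis using less.prems by (cases us) auto
  next
    case (Cons t ts')
    obtain u us' where us: "us = u # us'" using less.prems Cons by (cases us) auto
    obtain a b where ab: "t = Node a" "u = Node b" by (metis ptree.exhaust)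
    have "forest_contour a @ Down # forest_contour ts' @ x = forest_contour b @ Down # forest_contour us' @ y"
      using less.prems(1) Cons us ab by (simp add: contour_Node)
    then have "a = b \<and> Down # forest_contour ts' @ x = Down # forest_contour us' @ y"
      using less.hyps[of a "Down # forest_contour ts' @ x" b "Down # forest_contour us' @ y"] Cons ab
      by (simp add: contour_Node)
    moreover from this have "ts' = us' \<and> x = y"
      using less.hyps[of ts' x us' y] less.prems Cons by simp
    ultimately show ?thesis using Cons us ab by simp
  qed
qed

lemma contour_inj: "contour t = contour u \<Longrightarrow> t = u"
  using forest_contour_inj[of _ "[]" _ "[]"] by (cases t; cases u) (simp add: contour_Node)

lemma contour_surj: "w \<in> dyck n \<Longrightarrow> \<exists>t. contour t = w"
proof (induction "length w" arbitrary: w n rule: less_induct)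
  case less
  show ?case
  proof (cases w)
    case Nil
    then show ?thesis by (intro exI[of _ "Node []"]) (simp add: contour_Node)
  next
    case (Cons a R)
    have a: "a = Up" using less.prems Cons stays_nonneg_start[of "-1" R] by (cases a) (auto simp: dyck_iff)
    have "0 + rise R < 0" using less.prems Cons a by (simp add: dyck_iff)
    then obtain B C where BC: "R = B @ Down # C" "rise B = 0" "stays_nonneg 0 B"
      using first_descent[of 0 R] by auto
    have "B \<in> dyck (count_list B Up)" "C \<in> dyck (count_list C Up)"
      using less.prems Cons a BC by (auto simp: dyck_iff)
    then obtain t u where tu: "contour t = B" "contour u = C"
      using less.hyps[of B "count_list B Up"] less.hyps[of C "count_list C Up"] Cons BC by fastforce
    obtain us where "u = Node us" by (cases u)
    then show ?thesis using tu Cons a BC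
      by (intro exI[of _ "Node (t # us)"]) (simp add: contour_Node)
  qed
qed

section \<open>Preorder of addresses and the prefix relation\<close>

definition forest_traversal :: "nat \<Rightarrow> ptree list \<Rightarrow> vertex list" where
  "forest_traversal k ts = concat (map (\<lambda>(i, vs). map ((#) i) vs) (enumerate k (map traversal ts)))"

lemma forest_traversal_simps [simp]:
  "forest_traversal k [] = []"
  "forest_traversal k (t # ts) = map ((#) k) (traversal t) @ forest_traversal (Suc k) ts"
  by (simp_all add: forest_traversal_def)

lemma traversal_Node: "traversal (Node ts) = [] # forest_traversal 0 ts"
  by (simp add: forest_traversal_def)

declare traversal.simps [simp del]

lemma traversal_Cons: "traversal t = [] # tl (traversal t)"
  by (cases t) (simp add: traversal_Node)

lemma up_heights_contour: "up_heights h (contour t) = map (\<lambda>v. h + depth v) (tl (traversal t))"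
proof (induction t arbitrary: h)
  case (Node ts)
  have "up_heights h (forest_contour us) = map (\<lambda>v. h + depth v) (forest_traversal k us)"
    if "set us \<subseteq> set ts" for us k h
    using that
  proof (induction us arbitrary: k)
    case (Cons u us)
    have "rise (contour u) = 0" using contour_dyck by (simp add: dyck_iff)
    moreover have "up_heights (h + 1) (contour u) = map (\<lambda>v. h + 1 + depth v) (tl (traversal u))"
      using Node Cons.prems by simp
    ultimately show ?case using Cons
      by (subst forest_traversal_simps, subst traversal_Cons) (simp add: up_heights_append add.assoc)
  qed simp
  then show ?case by (simp add: contour_Node traversal_Node)
qed

text \<open>A preorder step cuts the address at some \<open>d\<close> and appends one index: 0 for a
  first child when nothing is cut, otherwise the next sibling of the ancestor at depth
  \<open>d + 1\<close>.\<close>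

definition next_vertex :: "vertex \<Rightarrow> vertex \<Rightarrow> bool" where
  "next_vertex v v' \<longleftrightarrow>
     (\<exists>d\<le>length v. v' = take d v @ [if d = length v then 0 else Suc (v ! d)])"

lemma next_vertex_Cons: "next_vertex v v' \<Longrightarrow> next_vertex (i # v) (i # v')"
  unfolding next_vertex_def by (elim exE conjE, rule_tac x = "Suc d" in exI) auto

lemma successively_next_vertex: "successively next_vertex (traversal t)"
proof (induction t)
  case (Node ts)
  \<comment> \<open>The statement about the head is what joins the last vertex of one subtree to the
    root of the next.\<close>
  have "successively next_vertex (forest_traversal k us) \<and>
      (us \<noteq> [] \<longrightarrow> forest_traversal k us \<noteq> [] \<and> hd (forest_traversal k us) = [k])"
    if "set us \<subseteq> set ts" for us k
    using that
  proof (induction us arbitrary: k)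
    case (Cons u us)
    let ?m = "map ((#) k) (traversal u)"
    have ne: "traversal u \<noteq> []" by (subst traversal_Cons) simp
    have "successively next_vertex (traversal u)" using Node Cons.prems by simp
    then have "successively next_vertex ?m"
      unfolding successively_map by (rule successively_mono) (rule next_vertex_Cons)
    moreover have "next_vertex (k # v) [Suc k]" for v
      unfolding next_vertex_def by (intro exI[of _ 0]) simp
    then have "next_vertex (last ?m) (hd (forest_traversal (Suc k) us))" if "us \<noteq> []"
      using that Cons ne by (simp add: last_map)
    moreover have "hd ?m = [k]" by (subst traversal_Cons) simp
    ultimately show ?case using Cons ne by (cases us) (auto simp: successively_append_iff)
  qed simp
  from this[of ts 0] show ?case
    by (cases "ts = []") (auto simp: traversal_Node successively_Cons next_vertex_def)
qed

text \<open>Lexicographic order restricted to addresses of which neither is a prefix of the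
  other.\<close>

definition branches_before :: "vertex \<Rightarrow> vertex \<Rightarrow> bool" where
  "branches_before u v \<longleftrightarrow>
     (\<exists>d. d < length u \<and> d < length v \<and> take d u = take d v \<and> u ! d < v ! d)"

lemma branches_not_prefix:
  assumes "branches_before u v" shows "\<not> prefix u v" "\<not> prefix v u"
  using assms by (auto simp: branches_before_def prefix_def nth_append)

text \<open>A step that cuts at or above the branching index increases the index there; a step that
  cuts below leaves the branching as it is. So a subtree once left is never entered again.\<close>

lemma branches_next:
  assumes "branches_before u v" "next_vertex v v'"
  shows "branches_before u v'"
proof -
  obtain d where d: "d < length u" "d < length v" "take d u = take d v" "u ! d < v ! d"
    using assms(1) by (auto simp: branches_before_def)
  obtain e where e: "e \<le> length v" "v' = take e v @ [if e = length v then 0 else Suc (v ! e)]"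
    using assms(2) by (auto simp: next_vertex_def)
  show ?thesis
  proof (cases "e \<le> d")
    case True
    have "take e u = take e v" using True d(3) by (metis min.absorb1 take_take)
    moreover have "u ! e \<le> v ! e" using True d by (cases "e = d") (simp, metis le_neq_trans nth_take order_refl)
    ultimately show ?thesis unfolding branches_before_def
      using True d e by (intro exI[of _ e]) (auto simp: nth_append)
  next
    case False
    then show ?thesis unfolding branches_before_def
      using d e by (intro exI[of _ d]) (auto simp: nth_append min_def)
  qed
qed

text \<open>The cut is either below \<open>u\<close>, and \<open>u\<close> survives as a prefix, or
  inside \<open>u\<close>, and some index of \<open>u\<close> is increased. The length of
  \<open>v'\<close> tells which, just as a comparison of depths extends \<open>desc\<close> by one
  step.\<close>

lemma prefix_next:
  assumes "prefix u v" "next_vertex v v'"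
  shows "length u < length v' \<and> prefix u v' \<or> length v' \<le> length u \<and> branches_before u v'"
proof -
  obtain z where z: "v = u @ z" using assms(1) by (auto simp: prefix_def)
  obtain e where e: "e \<le> length v" "v' = take e v @ [if e = length v then 0 else Suc (v ! e)]"
    using assms(2) by (auto simp: next_vertex_def)
  show ?thesis
  proof (cases "length u \<le> e")
    case True
    then have "take e v = u @ take (e - length u) z" using z by simp
    then show ?thesis using True e by (auto simp: prefix_def)
  next
    case False
    then show ?thesis using e z
      by (intro disjI2) (auto simp: branches_before_def nth_append intro!: exI[of _ e])
  qed
qed

section \<open>Vertices of a plane tree named by their preorder position\<close>

locale plane_tree =
  fixes T :: ptree and n :: nat and q :: "nat \<Rightarrow> int"
  assumes edges: "num_edges T = n" and q_def: "q = depths (contour T)"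
begin

abbreviation tr :: "nat \<Rightarrow> vertex" where
  "tr i \<equiv> traversal T ! i"

lemma dyck_contour: "contour T \<in> dyck n"
  using contour_dyck edges by blast

lemma q: "depth_seq n q"
  unfolding q_def by (rule depth_seq_depths[OF dyck_contour])

lemma length_traversal: "length (traversal T) = Suc n"
proof -
  have "length (tl (traversal T)) = n"
    using arg_cong[OF up_heights_contour[of 0 T], of length] dyck_contour by (simp add: dyck_iff)
  then show ?thesis by (subst traversal_Cons) simp
qed

lemma depth_tr: "i \<le> n \<Longrightarrow> depth (tr i) = q i"
  using up_heights_contour[of 0 T] dyck_contour length_traversal
  by (subst traversal_Cons) (auto simp: q_def depths_def dyck_iff nth_Cons')

lemma next_tr: "i < n \<Longrightarrow> next_vertex (tr i) (tr (Suc i))"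
  using successively_next_vertex[of T] length_traversal by (simp add: successively_conv_nth)

text \<open>Following the traversal from \<open>i\<close>, the address relation and
  \<open>desc\<close> change at the same step, the first at which the depth falls to that of
  \<open>i\<close> or lower; after that both are settled.\<close>

lemma desc_or_branches:
  assumes "i \<le> j" "j \<le> n"
  shows "desc q i j \<and> prefix (tr i) (tr j) \<or> \<not> desc q i j \<and> branches_before (tr i) (tr j)"
  using assms
proof (induction j rule: dec_induct)
  case (step j)
  have nx: "next_vertex (tr j) (tr (Suc j))" using next_tr step by simp
  have d: "desc q i (Suc j) \<longleftrightarrow> desc q i j \<and> length (tr i) < length (tr (Suc j))"
    using step depth_tr[of i] depth_tr[of "Suc j"] by (auto simp: desc_Suc)
  show ?case
    using step prefix_next[of "tr i", OF _ nx] branches_next[of "tr i", OF _ nx] d by fastforce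
qed simp

lemma prefix_iff_desc:
  assumes "i \<le> n" "j \<le> n" shows "prefix (tr i) (tr j) \<longleftrightarrow> desc q i j"
proof (cases "i \<le> j")
  case True
  then show ?thesis using desc_or_branches[OF True assms(2)] branches_not_prefix by blast
next
  case False
  then have ji: "j \<le> i" by simp
  have "\<not> prefix (tr i) (tr j)"
  proof
    assume pr: "prefix (tr i) (tr j)"
    then have "desc q j i" using desc_or_branches[OF ji assms(1)] branches_not_prefix by blast
    then have "q j < q i" using False by (auto dest: desc_less)
    then show False using prefix_length_le[OF pr] depth_tr[OF assms(1)] depth_tr[OF assms(2)] by simp
  qed
  then show ?thesis using False by (simp add: desc_def)
qed

lemma tr_inj: "i \<le> n \<Longrightarrow> j \<le> n \<Longrightarrow> tr i = tr j \<longleftrightarrow> i = j"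
proof
  assume ij: "i \<le> n" "j \<le> n" "tr i = tr j"
  then have "desc q i j" "desc q j i" using prefix_iff_desc[of i j] prefix_iff_desc[of j i] by simp_all
  then show "i = j" using desc_le by (intro le_antisym)
qed simp

lemma inj_on_tr: "inj_on tr {..n}"
  using tr_inj by (auto intro: inj_onI)

lemma tr_0: "tr 0 = []"
  by (subst traversal_Cons) simp

lemma vertices_tr: "vertices T = tr ` {..n}"
  unfolding vertices_def set_conv_nth using length_traversal by (auto simp: less_Suc_eq_le)

lemma visit_index_tr: "i \<le> n \<Longrightarrow> visit_index T (tr i) = i"
  unfolding visit_index_def using length_traversal tr_inj
  by (subst takeWhile_eq_take_P_nth[of i]) (auto simp: less_Suc_eq_le)

lemma precedes_tr: "i \<le> n \<Longrightarrow> j \<le> n \<Longrightarrow> precedes T (tr i) (tr j) \<longleftrightarrow> i < j"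
  by (simp add: precedes_def visit_index_tr)

lemma tr_in_leaves:
  assumes i: "i \<le> n"
  shows "tr i \<in> leaves T \<longleftrightarrow> 1 \<le> i \<and> leaf_at q i"
proof -
  have root: "tr i \<noteq> [] \<longleftrightarrow> 1 \<le> i" using tr_inj[OF i, of 0] tr_0 by auto
  have "(\<exists>c. tr i @ [c] \<in> vertices T) \<longleftrightarrow> \<not> leaf_at q i" if i1: "1 \<le> i"
  proof
    assume "\<exists>c. tr i @ [c] \<in> vertices T"
    then obtain c j where c: "j \<le> n" "tr i @ [c] = tr j" by (auto simp: vertices_tr)
    then have d: "desc q i j" using prefix_iff_desc[OF i, of j] by (metis prefixI)
    moreover have "i \<noteq> j" using c by auto
    ultimately have "i < j" using desc_le[of q i j] by simp
    then show "\<not> leaf_at q i" using d by (auto simp: desc_def)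
  next
    assume nl: "\<not> leaf_at q i"
    then have "Suc i \<le> n"
      using depth_seqD(4)[OF q, of "Suc i"] depth_seq_pos[OF q i1] by (cases "Suc i \<le> n") auto
    moreover from this have "length (tr i) < length (tr (Suc i))"
      using nl depth_tr[of i] depth_tr[of "Suc i"] by simp
    \<comment> \<open>Only a step without a cut makes the address longer.\<close>
    ultimately have "tr (Suc i) = tr i @ [0]"
      using next_tr[of i] by (auto simp: next_vertex_def)
    then show "\<exists>c. tr i @ [c] \<in> vertices T" using \<open>Suc i \<le> n\<close> vertices_tr
      by (metis atMost_iff image_eqI)
  qed
  then show ?thesis using root i by (auto simp: leaves_def vertices_tr)
qed

lemma leaves_tr: "leaves T = tr ` {i. 1 \<le> i \<and> i \<le> n \<and> leaf_at q i}"
proof -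
  have "leaves T \<subseteq> tr ` {..n}" using vertices_tr by (auto simp: leaves_def)
  then show ?thesis using tr_in_leaves by auto
qed

lemma internal_tr: "{v \<in> internal_vertices T. depth v > 0} = tr ` {i. 1 \<le> i \<and> i \<le> n \<and> \<not> leaf_at q i}"
proof -
  have "0 < depth (tr i) \<longleftrightarrow> 1 \<le> i" if "i \<le> n" for i
    using depth_tr[OF that] depth_seqD(1)[OF q] depth_seq_pos[OF q, of i] by (cases i) auto
  then show ?thesis using tr_in_leaves by (auto simp: internal_vertices_def vertices_tr)
qed

lemma leaves_below_tr:
  assumes "1 \<le> v" "v \<le> n"
  shows "leaves_below T (tr v) = tr ` {x. x \<le> n \<and> leaf_at q x \<and> desc q v x}"
proof -
  have "1 \<le> x" if "desc q v x" for x using desc_le[OF that] assms by simp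
  then show ?thesis using assms prefix_iff_desc unfolding leaves_below_def leaves_tr by auto
qed

lemma desc_le_n: "desc q v x \<Longrightarrow> 1 \<le> v \<Longrightarrow> v \<le> n \<Longrightarrow> x \<le> n"
  using desc_bounded[OF q] desc_le by (metis le_neq_implies_less)

text \<open>Lets condition (3), quantified over a vertex and a child index, be read as a condition
  on all vertices except the root.\<close>

lemma child_vertices: "(\<exists>t\<in>vertices T. \<exists>i. t @ [i] \<in> vertices T \<and> t @ [i] = s) \<longleftrightarrow>
    (\<exists>k. 1 \<le> k \<and> k \<le> n \<and> s = tr k)"
proof
  assume "\<exists>t\<in>vertices T. \<exists>i. t @ [i] \<in> vertices T \<and> t @ [i] = s"
  then obtain t i where s: "s \<in> vertices T" "s = t @ [i]" by blast
  then obtain k where k: "k \<le> n" "s = tr k" unfolding vertices_tr by blast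
  have "k \<noteq> 0" using k(2) s(2) tr_0 by (intro notI) simp
  then show "\<exists>k. 1 \<le> k \<and> k \<le> n \<and> s = tr k" using k by (intro exI[of _ k]) simp
next
  assume "\<exists>k. 1 \<le> k \<and> k \<le> n \<and> s = tr k"
  then obtain k where k: "1 \<le> k" "k \<le> n" "s = tr k" by blast
  then obtain j where j: "k = Suc j" by (cases k) auto
  obtain w where w: "w \<le> j" "desc q w k" "q w = q k - 1"
    using parent_exists[OF q] unfolding j by blast
  have wn: "w \<le> n" using w(1) j k by simp
  have "prefix (tr w) (tr k)" using prefix_iff_desc[OF wn k(2)] w by simp
  then obtain z where z: "tr k = tr w @ z" by (auto simp: prefix_def)
  then have "length z = 1" using depth_tr[OF wn] depth_tr[OF k(2)] w(3) by simp
  then obtain i where "z = [i]" by (cases z) auto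
  moreover have "tr w \<in> vertices T" "tr k \<in> vertices T" using wn k(2) by (auto simp: vertices_tr)
  ultimately show "\<exists>t\<in>vertices T. \<exists>i. t @ [i] \<in> vertices T \<and> t @ [i] = s"
    using z k(3) by (intro bexI[of _ "tr w"] exI[of _ i]) simp_all
qed

text \<open>The fictitious leaves after \<open>n\<close> have depth 1, for which condition (1)
  admits no label but \<open>-1\<close>.\<close>

definition lab :: "(vertex \<rightharpoonup> int) \<Rightarrow> nat \<Rightarrow> int" where
  "lab L i = (if i \<le> n then label L (tr i) else -1)"

lemma decorated_iff:
  "(T, L) \<in> decorated_trees n \<longleftrightarrow> dom L = leaves T \<and> decoration q (lab L)"
proof -
  let ?I = "\<lambda>i. 1 \<le> i \<and> i \<le> n"
  have after: "leaf_at q i" "q i = 1" "lab L i = -1" if "n < i" for i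
    using that depth_seqD(4)[OF q] by (auto simp: lab_def)
  have lab: "label L (tr i) = lab L i" if "i \<le> n" for i using that by (simp add: lab_def)
  define c1 where "c1 \<longleftrightarrow> (\<forall>x\<in>leaves T. label L x \<ge> -1) \<and> (\<forall>x\<in>leaves T. label L x < depth (butlast x))"
  define c2 where "c2 \<longleftrightarrow> (\<forall>v\<in>internal_vertices T. depth v > 0 \<longrightarrow>
    (\<exists>x\<in>leaves_below T v. label L x \<le> depth v - 2))"
  define c3 where "c3 \<longleftrightarrow> (\<forall>t\<in>vertices T. \<forall>i. t @ [i] \<in> vertices T \<longrightarrow>
    (\<forall>x\<in>leaves_below T (t @ [i]). label L x = depth t \<longrightarrow>
      (\<forall>y\<in>leaves_below T (t @ [i]). precedes T y x \<longrightarrow> label L y \<ge> depth t)))"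
  define d1 where "d1 \<longleftrightarrow> (\<forall>x\<ge>1. leaf_at q x \<longrightarrow> -1 \<le> lab L x \<and> lab L x \<le> q x - 2)"
  define d2 where "d2 \<longleftrightarrow> (\<forall>v\<ge>1. \<exists>x. leaf_at q x \<and> desc q v x \<and> lab L x \<le> q v - 2)"
  define d3 where "d3 \<longleftrightarrow> (\<forall>v\<ge>1. \<forall>x y. leaf_at q x \<longrightarrow> leaf_at q y \<longrightarrow> desc q v x \<longrightarrow> desc q v y \<longrightarrow>
        lab L x = q v - 1 \<longrightarrow> y < x \<longrightarrow> q v - 1 \<le> lab L y)"
  have 1: "c1 \<longleftrightarrow> d1"
  proof -
    have bl: "depth (butlast (tr x)) = q x - 1" if "?I x" for x
      using depth_tr[of x] that depth_seq_pos[OF q, of x] by (simp add: of_nat_diff)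
    have "c1 \<longleftrightarrow> (\<forall>x. ?I x \<and> leaf_at q x \<longrightarrow> -1 \<le> lab L x \<and> lab L x \<le> q x - 2)"
      unfolding c1_def leaves_tr using bl lab by auto
    also have "\<dots> \<longleftrightarrow> d1" 
    proof -
      have "-1 \<le> lab L x \<and> lab L x \<le> q x - 2" if "\<not> x \<le> n" for x using after[of x] that by simp
      then show ?thesis unfolding d1_def by blast
    qed
    finally show ?thesis .
  qed
  \<comment> \<open>Condition (2) speaks of internal vertices only. At a leaf \<open>v\<close> the
    witness is \<open>v\<close> itself, by the bound in \<open>d1\<close>.\<close>
  have 2: "c2 \<longleftrightarrow> d2" if d1
  proof -
    have "c2 \<longleftrightarrow> (\<forall>v\<in>{v \<in> internal_vertices T. depth v > 0}. \<exists>x\<in>leaves_below T v. label L x \<le> depth v - 2)"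
      unfolding c2_def by auto
    also have "\<dots> \<longleftrightarrow> (\<forall>v. ?I v \<and> \<not> leaf_at q v \<longrightarrow> (\<exists>x\<in>leaves_below T (tr v). label L x \<le> depth (tr v) - 2))"
      unfolding internal_tr by auto
    also have "\<dots> \<longleftrightarrow> (\<forall>v. ?I v \<and> \<not> leaf_at q v \<longrightarrow> (\<exists>x\<le>n. leaf_at q x \<and> desc q v x \<and> lab L x \<le> q v - 2))"
    proof (intro all_cong1 imp_cong refl)
      fix v assume v: "?I v \<and> \<not> leaf_at q v"
      show "(\<exists>x\<in>leaves_below T (tr v). label L x \<le> depth (tr v) - 2) \<longleftrightarrow>
          (\<exists>x\<le>n. leaf_at q x \<and> desc q v x \<and> lab L x \<le> q v - 2)"
        using leaves_below_tr[of v] depth_tr[of v] v lab by auto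
    qed
    also have "\<dots> \<longleftrightarrow> d2"
    proof
      assume a: "\<forall>v. ?I v \<and> \<not> leaf_at q v \<longrightarrow> (\<exists>x\<le>n. leaf_at q x \<and> desc q v x \<and> lab L x \<le> q v - 2)"
      show d2 unfolding d2_def
      proof (intro allI impI)
        fix v :: nat assume v: "1 \<le> v"
        show "\<exists>x. leaf_at q x \<and> desc q v x \<and> lab L x \<le> q v - 2"
        proof (cases "leaf_at q v")
          case True
          then show ?thesis using that v by (intro exI[of _ v]) (simp add: d1_def)
        next
          case False
          then have "v \<le> n" using after(1)[of v] by (cases "v \<le> n") auto
          then show ?thesis using a v False by blast
        qed
      qed
    next
      assume d2
      then show "\<forall>v. ?I v \<and> \<not> leaf_at q v \<longrightarrow> (\<exists>x\<le>n. leaf_at q x \<and> desc q v x \<and> lab L x \<le> q v - 2)"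
        unfolding d2_def using desc_le_n by blast
    qed
    finally show ?thesis .
  qed
  have 3: "c3 \<longleftrightarrow> d3"
  proof -
    define R where "R s a \<longleftrightarrow> (\<forall>x\<in>leaves_below T s. label L x = a \<longrightarrow>
      (\<forall>y\<in>leaves_below T s. precedes T y x \<longrightarrow> a \<le> label L y))" for s a
    have "c3 \<longleftrightarrow> (\<forall>t\<in>vertices T. \<forall>i. t @ [i] \<in> vertices T \<longrightarrow> R (t @ [i]) (depth (t @ [i]) - 1))"
      unfolding c3_def R_def by simp
    also have "\<dots> \<longleftrightarrow> (\<forall>s. (\<exists>t\<in>vertices T. \<exists>i. t @ [i] \<in> vertices T \<and> t @ [i] = s) \<longrightarrow> R s (depth s - 1))"
      by blast
    also have "\<dots> \<longleftrightarrow> (\<forall>v. ?I v \<longrightarrow> R (tr v) (depth (tr v) - 1))"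
      unfolding child_vertices by blast
    also have "\<dots> \<longleftrightarrow> d3"
    proof -
      have Rv: "R (tr v) (depth (tr v) - 1) \<longleftrightarrow>
          (\<forall>x y. leaf_at q x \<longrightarrow> leaf_at q y \<longrightarrow> desc q v x \<longrightarrow> desc q v y \<longrightarrow>
            lab L x = q v - 1 \<longrightarrow> y < x \<longrightarrow> q v - 1 \<le> lab L y)" if v: "?I v" for v
      proof -
        have le: "x \<le> n" if "desc q v x" for x using desc_le_n[OF that] v by simp
        have "R (tr v) (depth (tr v) - 1) \<longleftrightarrow> (\<forall>x\<in>{x. x \<le> n \<and> leaf_at q x \<and> desc q v x}. lab L x = q v - 1 \<longrightarrow>
            (\<forall>y\<in>{x. x \<le> n \<and> leaf_at q x \<and> desc q v x}. y < x \<longrightarrow> q v - 1 \<le> lab L y))"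
          unfolding R_def using leaves_below_tr[of v] depth_tr[of v] v by (simp add: lab precedes_tr)
        then show ?thesis using le by blast
      qed
      have vac: False if "n < v" "1 \<le> v" "desc q v x" "desc q v y" "y < x" for v x y
        using that desc_bounded[OF q, of v x] desc_le[of q v x] desc_le[of q v y] by simp
      show ?thesis
      proof
        assume a: "\<forall>v. ?I v \<longrightarrow> R (tr v) (depth (tr v) - 1)"
        show d3 unfolding d3_def
        proof (intro allI impI)
          fix v x y :: nat
          assume v: "1 \<le> v" and xy: "leaf_at q x" "leaf_at q y" "desc q v x" "desc q v y"
            "lab L x = q v - 1" "y < x"
          have vn: "v \<le> n" using vac[OF _ v xy(3,4,6)] by (cases "v \<le> n") auto
          show "q v - 1 \<le> lab L y" using a v vn Rv[of v] xy by blast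
        qed
      next
        assume d3
        then show "\<forall>v. ?I v \<longrightarrow> R (tr v) (depth (tr v) - 1)"
          unfolding d3_def using Rv by blast
      qed
    qed
    finally show ?thesis .
  qed
  have "(T, L) \<in> decorated_trees n \<longleftrightarrow> dom L = leaves T \<and> c1 \<and> c2 \<and> c3"
    using edges unfolding decorated_trees_def c1_def c2_def c3_def mem_Collect_eq prod.case by blast
  moreover have "decoration q (lab L) \<longleftrightarrow> d1 \<and> d2 \<and> d3"
    unfolding decoration_def d1_def d2_def d3_def ..
  ultimately show ?thesis using 1 2 3 by blast
qed

lemma is_first_low_leaf_tr:
  assumes "1 \<le> v" "v \<le> n" "x \<le> n"
  shows "is_first_low_leaf T L (tr v) (tr x) \<longleftrightarrow> first_low q (lab L) v x"
proof -
  have mem: "tr x \<in> leaves_below T (tr v) \<longleftrightarrow> leaf_at q x \<and> desc q v x"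
    unfolding leaves_below_tr[OF assms(1,2)] using assms tr_inj by auto
  have "(\<forall>y\<in>leaves_below T (tr v). label L y \<le> depth (tr v) - 2 \<longrightarrow> \<not> precedes T y (tr x)) \<longleftrightarrow>
      (\<forall>y\<le>n. leaf_at q y \<longrightarrow> desc q v y \<longrightarrow> lab L y \<le> q v - 2 \<longrightarrow> \<not> y < x)"
    unfolding leaves_below_tr[OF assms(1,2)]
    using assms depth_tr precedes_tr by (auto simp: lab_def)
  also have "\<dots> \<longleftrightarrow> (\<forall>y<x. leaf_at q y \<longrightarrow> desc q v y \<longrightarrow> q v - 2 < lab L y)"
    using assms(3) by (meson less_le_trans less_imp_le not_le)
  finally show ?thesis unfolding is_first_low_leaf_def first_low_def mem
    using assms depth_tr by (auto simp: lab_def)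
qed

text \<open>The charge of a leaf counts the internal vertices whose subtree in \<open>p\<close> ends
  there; the summand 1 in \<open>tree_P\<close> is the down step of the leaf itself.\<close>

lemma tree_P_word:
  assumes sync: "sync_seqs n p q" and ray: "ray_labelling p q (lab L)"
  shows "tree_P (T, L) = word n p"
proof -
  have pair: "ray_labelled_pair n p q (lab L)" using sync ray by (rule ray_labelled_pair.intro)
  have p: "depth_seq n p" and lf: "1 \<le> i \<Longrightarrow> leaf_at p i \<longleftrightarrow> leaf_at q i" for i
    using sync by (auto simp: sync_seqs_def)
  have ch: "int (charge T L (tr x)) = p x - p (Suc x)" if x: "1 \<le> x" "x \<le> n" "leaf_at q x" for x
  proof -
    let ?A = "{v. 1 \<le> v \<and> v \<le> n \<and> \<not> leaf_at q v \<and> first_low q (lab L) v x}"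
    have "{v \<in> internal_vertices T. depth v > 0 \<and> is_first_low_leaf T L v (tr x)}
        = {v \<in> {v \<in> internal_vertices T. depth v > 0}. is_first_low_leaf T L v (tr x)}" by auto
    also have "\<dots> = tr ` ?A"
      unfolding internal_tr using is_first_low_leaf_tr x by auto
    finally have "charge T L (tr x) = card (tr ` ?A)" by (simp add: charge_def)
    also have "\<dots> = card ?A" by (rule card_image[OF inj_on_subset[OF inj_on_tr]]) auto
    \<comment> \<open>Being internal in \<open>q\<close> excludes \<open>v = x\<close>. Conversely
      \<open>v < x\<close> gives \<open>v\<close> a child in \<open>p\<close>, so it is internal in
      \<open>q\<close> as well, the leaves being the same.\<close>
    also have "?A = {v. 1 \<le> v \<and> v < x \<and> desc p v x \<and> \<not> desc p v (Suc x)}"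
    proof (intro set_eqI iffI)
      fix v assume v: "v \<in> ?A"
      then have "desc p v x" "\<not> desc p v (Suc x)" using ray_labelled_pair.first_low_iff_last[OF pair] by auto
      moreover have "v \<noteq> x" using v x by auto
      ultimately show "v \<in> {v. 1 \<le> v \<and> v < x \<and> desc p v x \<and> \<not> desc p v (Suc x)}"
        using v desc_le[of p v x] by simp
    next
      fix v assume v: "v \<in> {v. 1 \<le> v \<and> v < x \<and> desc p v x \<and> \<not> desc p v (Suc x)}"
      then have "\<not> leaf_at p v" by (auto simp: desc_def)
      then show "v \<in> ?A" using v x lf[of v] ray_labelled_pair.first_low_iff_last[OF pair] by auto
    qed
    finally show ?thesis using card_last_descendant[OF p x(1)] lf[OF x(1)] x(3) by simp
  qed
  have run: "(if tr x \<in> leaves T then Up # replicate (1 + charge T L (tr x)) Down else [Up]) =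
      Up # replicate (nat (p x + 1 - p (Suc x))) Down" if x: "1 \<le> x" "x \<le> n" for x
  proof (cases "leaf_at q x")
    case True
    then have "nat (p x + 1 - p (Suc x)) = 1 + charge T L (tr x)" using ch[OF x] by simp
    then show ?thesis using True tr_in_leaves x by simp
  next
    case False
    then have "nat (p x + 1 - p (Suc x)) = 0" using lf[OF x(1)] depth_seqD(3)[OF p, of x] by simp
    then show ?thesis using False tr_in_leaves x by simp
  qed
  have "tl (traversal T) = map tr [1..<Suc n]"
    by (rule nth_equalityI) (simp_all add: length_traversal nth_tl del: upt_Suc)
  then have "tree_P (T, L) = concat (map (\<lambda>x. if tr x \<in> leaves T
      then Up # replicate (1 + charge T L (tr x)) Down else [Up]) [1..<Suc n])"
    by (simp add: o_def del: upt_Suc)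
  also have "\<dots> = word n p"
    unfolding word_def runs_def
    by (intro arg_cong[of _ _ concat] map_cong refl run) auto
  finally show ?thesis .
qed

lemma ray_label_seq:
  assumes sync: "sync_seqs n p q" and x: "1 \<le> x" "x \<le> n" "leaf_at q x"
    and w: "desc p w (Suc x)" "p w = p (Suc x) - 1"
  shows "ray_label (word n p) T x = q w - 1"
proof -
  have p: "depth_seq n p" and lf: "leaf_at p x" using sync x by (auto simp: sync_seqs_def)
  have "w \<le> n" using desc_le[OF w(1)] w x by (cases "w = Suc x") auto
  then show ?thesis using ray_label_word[OF p x(1,2) lf w, of T] depth_tr[of w]
      depth_seqD(1)[OF q] depth_seq_pos[OF q, of w] by (auto simp: of_nat_diff)
qed

definition ray_map :: "step list \<Rightarrow> vertex \<rightharpoonup> int" where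
  "ray_map P v = (if v \<in> leaves T then Some (ray_label P T (visit_index T v)) else None)"

lemma interval_R_contour: "interval_R (P, contour T) = (T, ray_map P)"
proof -
  have "(THE T'. contour T' = contour T) = T" using contour_inj by blast
  then show ?thesis by (simp add: fun_eq_iff ray_map_def)
qed

lemma ray_labelling_ray_map:
  assumes sync: "sync_seqs n p q"
  shows "ray_labelling p q (lab (ray_map (word n p)))"
  unfolding ray_labelling_def
proof (intro allI impI)
  fix x w :: nat
  assume x: "1 \<le> x" "leaf_at q x" and w: "desc p w (Suc x)" "p w = p (Suc x) - 1"
  have p: "depth_seq n p" using sync by (simp add: sync_seqs_def)
  show "lab (ray_map (word n p)) x = q w - 1"
  proof (cases "x \<le> n")
    case True
    then show ?thesis using ray_label_seq[OF sync x(1) True x(2) w] tr_in_leaves x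
      by (simp add: lab_def ray_map_def visit_index_tr)
  next
    case False
    \<comment> \<open>Beyond \<open>n\<close> the next vertex hangs from the root, and the default
      value of \<open>lab\<close> is the label required there.\<close>
    then have "p w = 0" using w depth_seqD(4)[OF p, of "Suc x"] by simp
    then have "w = 0" using depth_seq_pos[OF p, of w] by (cases w) auto
    then show ?thesis using False depth_seqD(1)[OF q] by (simp add: lab_def)
  qed
qed

text \<open>Every \<open>Suc x\<close> has a parent in \<open>p\<close>, so
  \<open>ray_labelling\<close> leaves no choice for the label of a leaf.\<close>

lemma ray_map_unique:
  assumes sync: "sync_seqs n p q" and ray: "ray_labelling p q (lab L)" and dom: "dom L = leaves T"
  shows "ray_map (word n p) = L"
proof
  fix v
  show "ray_map (word n p) v = L v"
  proof (cases "v \<in> leaves T")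
    case True
    then obtain x where x: "v = tr x" "1 \<le> x" "x \<le> n" "leaf_at q x" by (auto simp: leaves_tr)
    have "depth_seq n p" using sync by (simp add: sync_seqs_def)
    then obtain w where w: "desc p w (Suc x)" "p w = p (Suc x) - 1" using parent_exists by blast
    have "ray_label (word n p) T x = lab L x"
      using ray_label_seq[OF sync x(2-4) w] ray x w by (simp add: ray_labelling_def)
    moreover have "L v = Some (label L v)" using True dom by (metis domD option.sel)
    ultimately show ?thesis using True x by (simp add: ray_map_def lab_def visit_index_tr)
  next
    case False
    then have "v \<notin> dom L" using dom by simp
    then show ?thesis using False by (simp add: ray_map_def domIff)
  qed
qed

end

section \<open>The two maps are mutually inverse\<close>

lemma interval_to_tree:
  assumes "(P, Q) \<in> sync_intervals n"
  shows "interval_R (P, Q) \<in> decorated_trees n"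
    "(tree_P (interval_R (P, Q)), tree_Q (interval_R (P, Q))) = (P, Q)"
proof -
  have PQ: "P \<in> dyck n" "Q \<in> dyck n" using assms by (auto simp: sync_intervals_def)
  obtain T where T: "contour T = Q" using contour_surj PQ by blast
  have "num_edges T = n" using contour_dyck[of T] PQ T by (simp add: dyck_iff)
  then interpret plane_tree T n "depths Q" using T by unfold_locales auto
  have sync: "sync_seqs n (depths P) (depths Q)" using assms sync_intervals_iff[OF PQ] by simp
  have R: "interval_R (P, Q) = (T, ray_map P)" using interval_R_contour T by simp
  have ray: "ray_labelling (depths P) (depths Q) (lab (ray_map P))"
    using ray_labelling_ray_map[OF sync] word_depths[OF PQ(1)] by simp
  have "dom (ray_map P) = leaves T" by (auto simp: ray_map_def dom_def)
  then show "interval_R (P, Q) \<in> decorated_trees n"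
    unfolding R decorated_iff using ray_labelled_pair.decoration_of_sync[OF ray_labelled_pair.intro[OF sync ray]] by simp
  show "(tree_P (interval_R (P, Q)), tree_Q (interval_R (P, Q))) = (P, Q)"
    unfolding R using tree_P_word[OF sync ray] word_depths[OF PQ(1)] T by simp
qed

lemma tree_to_interval:
  assumes "S \<in> decorated_trees n"
  shows "(tree_P S, tree_Q S) \<in> sync_intervals n" "interval_R (tree_P S, tree_Q S) = S"
proof -
  obtain T L where S: "S = (T, L)" by (cases S)
  have "num_edges T = n" using assms S by (simp add: decorated_trees_def)
  then interpret plane_tree T n "depths (contour T)" by unfold_locales auto
  let ?q = "depths (contour T)"
  have dec: "dom L = leaves T" "decoration ?q (lab L)" using assms S decorated_iff by auto
  obtain p where p: "sync_seqs n p ?q" "ray_labelling p ?q (lab L)"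
    using sync_of_decoration[OF q dec(2)] by blast
  have P: "tree_P S = word n p" "tree_Q S = contour T" using tree_P_word[OF p] S by auto
  have "depth_seq n p" using p by (simp add: sync_seqs_def)
  then show "(tree_P S, tree_Q S) \<in> sync_intervals n"
    using sync_intervals_iff[OF word_dyck(1) dyck_contour] word_dyck(2) p P by simp
  show "interval_R (tree_P S, tree_Q S) = S"
    unfolding P interval_R_contour using ray_map_unique[OF p dec(1)] S by simp
qed

theorem theorem4:
  fixes n :: nat
  assumes "n \<ge> 1"
  shows "bij_betw interval_R (sync_intervals n) (decorated_trees n) \<and>
         (\<forall>S\<in>decorated_trees n.
            the_inv_into (sync_intervals n) interval_R S = (tree_P S, tree_Q S))"
proof -
  have bij: "bij_betw interval_R (sync_intervals n) (decorated_trees n)"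
    by (rule bij_betw_byWitness[where f' = "\<lambda>S. (tree_P S, tree_Q S)"])
      (use interval_to_tree tree_to_interval in auto)
  moreover have "the_inv_into (sync_intervals n) interval_R S = (tree_P S, tree_Q S)"
    if "S \<in> decorated_trees n" for S
    using bij tree_to_interval[OF that] by (intro the_inv_into_f_eq) (auto simp: bij_betw_def)
  ultimately show ?thesis by blast
qed

end
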